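(* Let $k\ge 3$ be a constant integer and set $p=k+\lfloor k^2/4\rfloor$. There are $O((kn)^2)$-time reductions from $k$-Clique to $p$-DP and to $p$-DSP on unweighted DAGs with $O(kn)$ vertices; that is, given an instance $G$ of $k$-Clique one can construct in $O((kn)^2)$ time an unweighted DAG $G'$ with $O(kn)$ vertices and $p$ source–target pairs such that $G$ has a $k$-clique if and only if $G'$ is a yes-instance of $p$-DP, and likewise (for such a construction) if and only if $G'$ is a yes-instance of $p$-DSP.
   Context: In the $k$-Clique problem, the input is a $k$-partite graph with parts $V_1,\dots,V_k$, each of $n$ vertices, and one must decide whether it contains a $k$-clique. In $p$-Disjoint Paths ($p$-DP), given a graph with sources $s_1,\dots,s_p$ and targets $t_1,\dots,t_p$, one must decide whether there exist pairwise internally vertex-disjoint paths $P_1,\dots,P_p$ with $P_i$ an $(s_i,t_i)$-path. In $p$-DSP one additionally requires each $P_i$ to be a shortest $(s_i,t_i)$-path (edge weights positive; unweighted means all weights $1$). *)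

theory Defs
  imports "Graph_Theory.Graph_Theory" "HOL-Library.Landau_Symbols"
begin

section \<open>Disjoint paths and disjoint shortest paths\<close>

text \<open>
  Paths are given by their arc lists. Internally vertex-disjoint means that no inner vertex of one
  path lies on another path; only common end points are allowed.
\<close>

definition internally_disjoint ::
    "('a, 'b) pre_digraph \<Rightarrow> nat \<Rightarrow> (nat \<Rightarrow> 'a) \<Rightarrow> (nat \<Rightarrow> 'b awalk) \<Rightarrow> bool" where
  "internally_disjoint G p s P \<longleftrightarrow>
     (\<forall>i<p. \<forall>j<p. i \<noteq> j \<longrightarrow>
        set (pre_digraph.inner_verts G (P i)) \<inter> set (pre_digraph.awalk_verts G (s j) (P j)) = {})"

definition disjoint_paths ::
    "('a, 'b) pre_digraph \<Rightarrow> nat \<Rightarrow> (nat \<Rightarrow> 'a) \<Rightarrow> (nat \<Rightarrow> 'a) \<Rightarrow> bool" where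
  "disjoint_paths G p s t \<longleftrightarrow>
     (\<exists>P. (\<forall>i<p. pre_digraph.apath G (s i) (P i) (t i)) \<and> internally_disjoint G p s P)"

definition shortest_path ::
    "('a, 'b) pre_digraph \<Rightarrow> 'b weight_fun \<Rightarrow> 'a \<Rightarrow> 'b awalk \<Rightarrow> 'a \<Rightarrow> bool" where
  "shortest_path G f u q v \<longleftrightarrow>
     pre_digraph.apath G u q v \<and> ereal (wf_digraph.awalk_cost f q) = wf_digraph.\<mu> G f u v"

definition disjoint_shortest_paths ::
    "('a, 'b) pre_digraph \<Rightarrow> 'b weight_fun \<Rightarrow> nat \<Rightarrow> (nat \<Rightarrow> 'a) \<Rightarrow> (nat \<Rightarrow> 'a) \<Rightarrow> bool" where
  "disjoint_shortest_paths G f p s t \<longleftrightarrow>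
     (\<exists>P. (\<forall>i<p. shortest_path G f (s i) (P i) (t i)) \<and> internally_disjoint G p s P)"

abbreviation unit_weight :: "'b weight_fun" where
  "unit_weight \<equiv> (\<lambda>_. 1)"

text \<open>Loops and pairs of antiparallel arcs are cycles in the sense of \<^const>\<open>pre_digraph.cycle\<close>.\<close>

definition dag :: "('a, 'b) pre_digraph \<Rightarrow> bool" where
  "dag G \<longleftrightarrow> wf_digraph G \<and> (\<nexists>q. pre_digraph.cycle G q)"


section \<open>The clique problem on multipartite graphs\<close>

text \<open>
  Undirected graphs are symmetric loop-free digraphs. As graphs are inputs of a machine, their
  vertices are numbers; the \<open>i\<close>-th part consists of the \<open>n\<close> numbers from \<open>i * n\<close> on.
\<close>

definition part :: "nat \<Rightarrow> nat \<Rightarrow> nat set" where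
  "part n i = {i * n ..< (i + 1) * n}"

definition multipartite_graph :: "nat \<Rightarrow> nat \<Rightarrow> nat pair_pre_digraph \<Rightarrow> bool" where
  "multipartite_graph k n G \<longleftrightarrow>
     pair_graph G \<and> pverts G = (\<Union>i<k. part n i) \<and>
     (\<forall>i<k. \<forall>u \<in> part n i. \<forall>v \<in> part n i. (u, v) \<notin> parcs G)"

definition has_clique :: "nat \<Rightarrow> 'a pair_pre_digraph \<Rightarrow> bool" where
  "has_clique k G \<longleftrightarrow>
     (\<exists>S \<subseteq> pverts G. finite S \<and> card S = k \<and> (\<forall>u\<in>S. \<forall>v\<in>S. u \<noteq> v \<longrightarrow> (u, v) \<in> parcs G))"


section \<open>A structured word RAM\<close>

text \<open>
  The machine has registers (addressed by constants occurring in the program) and a random access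
  memory (addressed by computed values). It operates on words of \<open>w\<close> bits: every constant and every
  result of an operation is reduced modulo \<open>2 ^ w\<close>. Subtraction is truncated at \<open>0\<close>, division by
  \<open>0\<close> yields \<open>0\<close>, and comparisons yield \<open>0\<close> or \<open>1\<close>. Every operation, memory access,
  assignment and branch takes unit time.
\<close>

datatype operator = Plus | Minus | Times | Quot | Rem | Less | Equal

datatype expr =
    Const nat
  | Reg nat
  | Load expr
  | Op operator expr expr

datatype prog =
    Skip
  | SetReg nat expr
  | Store expr expr
  | Seq prog prog
  | Cond expr prog prog
  | While expr prog

record ram_state =
  regs :: "nat \<Rightarrow> nat"
  mem :: "nat \<Rightarrow> nat"

fun apply_op :: "operator \<Rightarrow> nat \<Rightarrow> nat \<Rightarrow> nat" where
  "apply_op Plus a b = a + b"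
| "apply_op Minus a b = a - b"
| "apply_op Times a b = a * b"
| "apply_op Quot a b = a div b"
| "apply_op Rem a b = a mod b"
| "apply_op Less a b = (if a < b then 1 else 0)"
| "apply_op Equal a b = (if a = b then 1 else 0)"

primrec expr_val :: "nat \<Rightarrow> ram_state \<Rightarrow> expr \<Rightarrow> nat" where
  "expr_val w \<sigma> (Const c) = c mod 2 ^ w"
| "expr_val w \<sigma> (Reg r) = regs \<sigma> r"
| "expr_val w \<sigma> (Load e) = mem \<sigma> (expr_val w \<sigma> e)"
| "expr_val w \<sigma> (Op f e1 e2) = apply_op f (expr_val w \<sigma> e1) (expr_val w \<sigma> e2) mod 2 ^ w"

primrec expr_time :: "expr \<Rightarrow> nat" where
  "expr_time (Const c) = 1"
| "expr_time (Reg r) = 1"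
| "expr_time (Load e) = expr_time e + 1"
| "expr_time (Op f e1 e2) = expr_time e1 + expr_time e2 + 1"

text \<open>\<open>exec w c \<sigma> \<tau> \<sigma>'\<close>: started in \<open>\<sigma>\<close>, the program \<open>c\<close> halts in \<open>\<sigma>'\<close> after exactly \<open>\<tau>\<close> steps.\<close>

inductive exec :: "nat \<Rightarrow> prog \<Rightarrow> ram_state \<Rightarrow> nat \<Rightarrow> ram_state \<Rightarrow> bool" for w where
  exec_Skip: "exec w Skip \<sigma> 1 \<sigma>"
| exec_SetReg:
    "exec w (SetReg r e) \<sigma> (expr_time e + 1) (\<sigma>\<lparr>regs := (regs \<sigma>)(r := expr_val w \<sigma> e)\<rparr>)"
| exec_Store:
    "exec w (Store e1 e2) \<sigma> (expr_time e1 + expr_time e2 + 1)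
       (\<sigma>\<lparr>mem := (mem \<sigma>)(expr_val w \<sigma> e1 := expr_val w \<sigma> e2)\<rparr>)"
| exec_Seq:
    "exec w c1 \<sigma> \<tau>1 \<sigma>' \<Longrightarrow> exec w c2 \<sigma>' \<tau>2 \<sigma>'' \<Longrightarrow> exec w (Seq c1 c2) \<sigma> (\<tau>1 + \<tau>2) \<sigma>''"
| exec_Cond_true:
    "expr_val w \<sigma> e \<noteq> 0 \<Longrightarrow> exec w c1 \<sigma> \<tau> \<sigma>' \<Longrightarrow>
     exec w (Cond e c1 c2) \<sigma> (expr_time e + 1 + \<tau>) \<sigma>'"
| exec_Cond_false:
    "expr_val w \<sigma> e = 0 \<Longrightarrow> exec w c2 \<sigma> \<tau> \<sigma>' \<Longrightarrow>
     exec w (Cond e c1 c2) \<sigma> (expr_time e + 1 + \<tau>) \<sigma>'"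
| exec_While_true:
    "expr_val w \<sigma> e \<noteq> 0 \<Longrightarrow> exec w c \<sigma> \<tau>1 \<sigma>' \<Longrightarrow> exec w (While e c) \<sigma>' \<tau>2 \<sigma>'' \<Longrightarrow>
     exec w (While e c) \<sigma> (expr_time e + 1 + \<tau>1 + \<tau>2) \<sigma>''"
| exec_While_false:
    "expr_val w \<sigma> e = 0 \<Longrightarrow> exec w (While e c) \<sigma> (expr_time e + 1) \<sigma>"


section \<open>Reductions from the clique problem\<close>

text \<open>
  Input: \<open>n\<close> in register 0 and the adjacency matrix, row by row, at the start of the memory;
  everything else is 0.
\<close>

definition clique_input :: "nat \<Rightarrow> nat \<Rightarrow> nat pair_pre_digraph \<Rightarrow> ram_state" where
  "clique_input k n G =
     \<lparr>regs = (\<lambda>r. if r = 0 then n else 0),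
      mem = (\<lambda>a. if a < (k * n)\<^sup>2 \<and> (a div (k * n), a mod (k * n)) \<in> parcs G then 1 else 0)\<rparr>"

text \<open>
  Output: the number \<open>N\<close> of vertices in register 0, the start address of the \<open>N \<times> N\<close> adjacency
  matrix in register 1, and in register 2 the start address of the list
  \<open>s\<^sub>0, t\<^sub>0, s\<^sub>1, t\<^sub>1, \<dots>\<close> of terminals.
\<close>

definition output_graph :: "ram_state \<Rightarrow> nat pair_pre_digraph" where
  "output_graph \<sigma> = (let N = regs \<sigma> 0 in
     \<lparr>pverts = {..<N},
      parcs = {(u, v). u < N \<and> v < N \<and> mem \<sigma> (regs \<sigma> 1 + u * N + v) \<noteq> 0}\<rparr>)"

definition output_source :: "ram_state \<Rightarrow> nat \<Rightarrow> nat" where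
  "output_source \<sigma> i = mem \<sigma> (regs \<sigma> 2 + 2 * i)"

definition output_target :: "ram_state \<Rightarrow> nat \<Rightarrow> nat" where
  "output_target \<sigma> i = mem \<sigma> (regs \<sigma> 2 + 2 * i + 1)"

text \<open>
  The program \<open>c\<close> maps every instance of \<open>k\<close>-Clique with parts of size \<open>n\<close> to an equivalent
  instance of the problem \<open>Q\<close> on DAGs with \<open>p\<close> terminal pairs. It takes at most \<open>T n\<close> steps on
  every machine whose words have at least \<open>W n\<close> bits, and the DAG has at most \<open>S n\<close> vertices.
\<close>

definition clique_reduction ::
    "nat \<Rightarrow> nat \<Rightarrow> (nat pair_pre_digraph \<Rightarrow> (nat \<Rightarrow> nat) \<Rightarrow> (nat \<Rightarrow> nat) \<Rightarrow> bool) \<Rightarrow>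
     prog \<Rightarrow> (nat \<Rightarrow> nat) \<Rightarrow> (nat \<Rightarrow> nat) \<Rightarrow> (nat \<Rightarrow> nat) \<Rightarrow> bool" where
  "clique_reduction k p Q c W T S \<longleftrightarrow>
     (\<forall>n\<ge>1. \<forall>G. multipartite_graph k n G \<longrightarrow> (\<forall>w \<ge> W n.
        \<exists>\<tau> \<sigma>. exec w c (clique_input k n G) \<tau> \<sigma> \<and> \<tau> \<le> T n \<and>
          dag (output_graph \<sigma>) \<and> card (pverts (output_graph \<sigma>)) \<le> S n \<and>
          (\<forall>i<p. output_source \<sigma> i \<in> pverts (output_graph \<sigma>) \<and>
                 output_target \<sigma> i \<in> pverts (output_graph \<sigma>)) \<and>
          (has_clique k G \<longleftrightarrow> Q (output_graph \<sigma>) (output_source \<sigma>) (output_target \<sigma>))))"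

end

theory Submission
  imports Defs "HOL-Library.Log_Nat"
begin

text \<open>
  Part \<open>i\<close> of the clique instance becomes a row of two parallel lines, divided into \<open>n\<close> blocks of \<open>p\<close>
  columns. Its row path runs along the upper line and may change to the lower line either straight
  down or by jumping over exactly one block; hence at most one block, the selected vertex, is free
  on both lines. The \<open>k\<^sup>2 div 4\<close> remaining paths, called crossers, each own one column of every
  block and descend through the selected blocks of several rows in increasing order; the arc from
  one row to the next encodes an edge of the clique instance. The pairs \<open>i < j\<close> of rows decompose
  into \<open>k\<^sup>2 div 4\<close> increasing chains, so all of them get checked. All row paths and crossers arising
  from a clique turn out to be shortest, which handles both problems with the same graph.
\<close>

section \<open>Potentials on walks\<close>

text \<open>No single arc ties a crosser to its column: the lines that it crosses also let it step
  to the right. It is tied by the row paths. They confine it to the selected blocks, where the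
  column can only grow, while its target can be entered from column \<open>c\<close> alone; so one
  step to the right is fatal, and the crosser has to use the jump arcs of its own column in every
  row of its chain. The rungs are there for the crossers; a row path that takes one merely blocks
  more vertices. The arc over a block makes every row path that uses it equally long,
  \<open>n * p - p + 1\<close> arcs, whichever block it selects. This is also the minimum, because
  the last row position is never reached with two such arcs: they only lead downwards. Hence the
  freedom of choice survives when shortest paths are demanded.\<close>

context wf_digraph begin

text \<open>Summing the increments along a walk bounds its length from below by
  \<open>f w - f u\<close>; a walk that attains this bound is therefore shortest.\<close>

lemma awalk_potential_le:
  fixes f :: "'a \<Rightarrow> nat"
  assumes "\<And>e. e \<in> arcs G \<Longrightarrow> f (head G e) \<le> f (tail G e) + 1" "awalk u q w"
  shows "f w \<le> f u + length q"
  using assms(2)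
proof (induction q arbitrary: u)
  case (Cons e q)
  then have "f w \<le> f (head G e) + length q" "e \<in> arcs G" "u = tail G e"
    by (auto simp: awalk_Cons_iff)
  with assms(1)[of e] show ?case by simp
qed (simp add: awalk_Nil_iff)

lemma awalk_rank_le:
  fixes f :: "'a \<Rightarrow> nat"
  assumes "\<And>e. e \<in> arcs G \<Longrightarrow> f (tail G e) < f (head G e)" "awalk u q w"
  shows "f u + length q \<le> f w"
  using assms(2)
proof (induction q arbitrary: u)
  case (Cons e q)
  then have "f (head G e) + length q \<le> f w" "e \<in> arcs G" "u = tail G e"
    by (auto simp: awalk_Cons_iff)
  with assms(1)[of e] show ?case by simp
qed (simp add: awalk_Nil_iff)

lemma ranked_awalk_is_apath:
  fixes f :: "'a \<Rightarrow> nat"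
  assumes "\<And>e. e \<in> arcs G \<Longrightarrow> f (tail G e) < f (head G e)" "awalk u q w"
  shows "apath u q w"
proof -
  have "distinct (awalk_verts u q) \<and> (\<forall>x \<in> set (awalk_verts u q). f u \<le> f x)"
    using assms(2)
  proof (induction q arbitrary: u)
    case (Cons e q)
    then have "awalk (head G e) q w" "e \<in> arcs G" "u = tail G e"
      by (auto simp: awalk_Cons_iff)
    with assms(1)[of e] Cons.IH[of "head G e"] show ?case by fastforce
  qed simp
  with assms(2) show ?thesis by (simp add: apath_def)
qed

lemma ranked_dag:
  fixes f :: "'a \<Rightarrow> nat"
  assumes "\<And>e. e \<in> arcs G \<Longrightarrow> f (tail G e) < f (head G e)"
  shows "dag G"
  unfolding dag_def
proof
  show "wf_digraph G" by unfold_locales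
  show "\<nexists>q. cycle q"
  proof
    assume "\<exists>q. cycle q"
    then obtain q u where "awalk u q u" "q \<noteq> []" by (auto simp: cycle_def)
    with awalk_rank_le[where f = f, OF assms] show False by force
  qed
qed

text \<open>\<open>\<mu>\<close> is an infimum over all walks, hence the comparison with walks
  rather than paths.\<close>

lemma shortest_path_unit_weightI:
  assumes "apath u q w" "\<And>q'. awalk u q' w \<Longrightarrow> length q \<le> length q'"
  shows "shortest_path G unit_weight u q w"
proof -
  have cost: "awalk_cost unit_weight q' = real (length q')" for q' :: "'b awalk"
    by (simp add: awalk_cost_def sum_list_triv)
  have "\<mu> unit_weight u w = ereal (awalk_cost unit_weight q)"
    unfolding \<mu>_def
    by (rule antisym, rule INF_lower)
       (use assms in \<open>auto intro!: INF_greatest simp: cost apath_def\<close>)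
  with assms(1) show ?thesis by (simp add: shortest_path_def)
qed

end

section \<open>The gadget graph\<close>

definition successive :: "nat set \<Rightarrow> nat \<Rightarrow> nat \<Rightarrow> bool" where
  "successive X i j \<longleftrightarrow> i \<in> X \<and> j \<in> X \<and> i < j \<and> X \<inter> {i<..<j} = {}"

text \<open>Collects every change of row that crosser \<open>c\<close> may make. The number
  \<open>c\<close>, being at least \<open>k\<close>, stands for its source as a first row and for
  its target as a second one, so a single table covers entering, leaving and jumping.\<close>

definition link :: "nat \<Rightarrow> nat \<Rightarrow> (nat \<Rightarrow> nat set) \<Rightarrow> nat \<Rightarrow> nat \<Rightarrow> nat \<Rightarrow> bool" where
  "link k p Q c r r' \<longleftrightarrow> k \<le> c \<and> c < p \<and>
     (r = c \<and> r' = Min (Q c) \<or> r = Max (Q c) \<and> r' = c \<or> successive (Q c) r r')"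

text \<open>Row, layer and position are the digits of a vertex number in mixed radix, which the
  program can read off by division and remainder.\<close>

definition row :: "nat \<Rightarrow> nat \<Rightarrow> nat" where "row L u = u div L div 2"
definition layer :: "nat \<Rightarrow> nat \<Rightarrow> nat" where "layer L u = u div L mod 2"
definition pos :: "nat \<Rightarrow> nat \<Rightarrow> nat" where "pos L u = u mod L"
definition node :: "nat \<Rightarrow> nat \<Rightarrow> nat \<Rightarrow> nat \<Rightarrow> nat" where "node L r l x = (r * 2 + l) * L + x"

text \<open>
  The \<open>p\<close> terminal pairs are the nodes \<open>(i, 0, 0)\<close> and \<open>(i, 1, n * p)\<close>. Rows \<open>c \<ge> k\<close> belong to crossers and
  only their terminals have arcs. Position \<open>v * p + c\<close> is column \<open>c\<close> of block \<open>v\<close>; crosser \<open>c\<close> uses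
  the column \<open>c\<close>, so column \<open>0\<close> merely separates the blocks. \<open>E\<close> is the edge relation of the clique
  instance.
\<close>

definition gadget_arc ::
    "nat \<Rightarrow> nat \<Rightarrow> nat \<Rightarrow> (nat \<Rightarrow> nat \<Rightarrow> nat \<Rightarrow> bool) \<Rightarrow> (nat \<Rightarrow> nat \<Rightarrow> bool) \<Rightarrow> nat \<Rightarrow> nat \<Rightarrow> bool" where
  "gadget_arc k p n lk E u v \<longleftrightarrow>
     (let L = n * p + 1; r = row L u; l = layer L u; x = pos L u;
          r' = row L v; l' = layer L v; x' = pos L v in
        r < k \<and> r' = r \<and> l' = l \<and> x' = x + 1
      \<or> r < k \<and> r' = r \<and> l = 0 \<and> l' = 1 \<and> x' = x
      \<or> r < k \<and> r' = r \<and> l = 0 \<and> l' = 1 \<and> x mod p = 0 \<and> x' = x + p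
      \<or> l = 0 \<and> x = 0 \<and> l' = 0 \<and> x' mod p = r \<and> lk r r r'
      \<or> l = 1 \<and> l' = 1 \<and> x' = n * p \<and> x mod p = r' \<and> lk r' r r'
      \<or> r < k \<and> r' < k \<and> l = 1 \<and> l' = 0 \<and> x' mod p = x mod p \<and> lk (x mod p) r r' \<and>
          E (r * n + x div p) (r' * n + x' div p))"

definition gadget_graph ::
    "nat \<Rightarrow> nat \<Rightarrow> nat \<Rightarrow> (nat \<Rightarrow> nat \<Rightarrow> nat \<Rightarrow> bool) \<Rightarrow> (nat \<Rightarrow> nat \<Rightarrow> bool) \<Rightarrow> nat pair_pre_digraph" where
  "gadget_graph k p n lk E =
     (let N = 2 * p * (n * p + 1) in
      \<lparr>pverts = {..<N}, parcs = {(u, v). u < N \<and> v < N \<and> gadget_arc k p n lk E u v}\<rparr>)"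

locale gadget =
  fixes k p n :: nat and Q :: "nat \<Rightarrow> nat set" and E :: "nat \<Rightarrow> nat \<Rightarrow> bool"
  assumes n_pos: "0 < n" and k_pos: "0 < k" and k_less_p: "k < p" and two_k_le: "2 * k \<le> p + 2"
    and Q_rows: "\<And>c. k \<le> c \<Longrightarrow> c < p \<Longrightarrow> Q c \<noteq> {} \<and> Q c \<subseteq> {..<k}"
    and Q_cover: "\<And>i j. i < j \<Longrightarrow> j < k \<Longrightarrow> \<exists>c. k \<le> c \<and> c < p \<and> successive (Q c) i j"
begin

section \<open>Coordinates and kinds of arcs\<close>

definition L :: nat where "L = n * p + 1"
abbreviation "N \<equiv> 2 * p * L"
abbreviation "R \<equiv> row L"
abbreviation "Y \<equiv> layer L"
abbreviation "X \<equiv> pos L"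
abbreviation "nd \<equiv> node L"
abbreviation "s i \<equiv> nd i 0 0"
abbreviation "t i \<equiv> nd i 1 (n * p)"
abbreviation "H \<equiv> gadget_graph k p n (link k p Q) E"
abbreviation "arc \<equiv> gadget_arc k p n (link k p Q) E"

sublocale H: wf_digraph "with_proj H"
  by unfold_locales (auto simp: gadget_graph_def Let_def)

lemma less_L_iff: "x < L \<longleftrightarrow> x \<le> n * p"
  by (simp add: L_def less_Suc_eq_le)

lemma node_coords [simp]:
  assumes "l < 2" "x \<le> n * p"
  shows "R (nd r l x) = r" "Y (nd r l x) = l" "X (nd r l x) = x"
  using assms less_L_iff[of x] by (simp_all add: row_def layer_def pos_def node_def)

lemma node_of_coords [simp]: "nd (R u) (Y u) (X u) = u"
  unfolding row_def layer_def pos_def node_def by (simp only: div_mult_mod_eq)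

lemma node_less: "r < p \<Longrightarrow> l < 2 \<Longrightarrow> x \<le> n * p \<Longrightarrow> nd r l x < N"
proof -
  assume "r < p" "l < 2" "x \<le> n * p"
  then have "Suc (r * 2 + l) * L \<le> (2 * p) * L" "x < L"
    by (auto intro!: mult_le_mono1 simp: less_L_iff simp del: mult_Suc)
  then show ?thesis by (simp add: node_def)
qed

lemma pos_le: "X u \<le> n * p"
  using mod_less_divisor[of L u] by (simp add: pos_def L_def)

lemma layer_cases: "Y u = 0 \<or> Y u = 1"
  by (auto simp: layer_def)

lemma finite_Q: "k \<le> c \<Longrightarrow> c < p \<Longrightarrow> finite (Q c)"
  using Q_rows finite_subset by blast

lemma Q_less: "k \<le> c \<Longrightarrow> c < p \<Longrightarrow> r \<in> Q c \<Longrightarrow> r < k"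
  using Q_rows by blast

lemma Min_Max_Q:
  assumes "k \<le> c" "c < p"
  shows "Min (Q c) \<in> Q c" "Max (Q c) \<in> Q c"
  using Q_rows[OF assms] finite_Q[OF assms] by auto

lemma successive_less: "k \<le> c \<Longrightarrow> c < p \<Longrightarrow> successive (Q c) r r' \<Longrightarrow> r < k \<and> r' < k"
  using Q_less by (auto simp: successive_def)

lemma Min_Max_Q_less: "k \<le> c \<Longrightarrow> c < p \<Longrightarrow> Min (Q c) < k \<and> Max (Q c) < k"
  using Q_less Min_Max_Q by auto

text \<open>Members of \<open>Q c\<close> lie below \<open>k\<close> and \<open>c\<close> does not,
  so knowing which argument equals \<open>c\<close> leaves only one disjunct of
  \<open>link\<close>.\<close>

lemma link_enter: "link k p Q c c r \<longleftrightarrow> k \<le> c \<and> c < p \<and> r = Min (Q c)"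
  using successive_less[of c c r] Min_Max_Q_less[of c] by (auto simp: link_def)

lemma link_leave: "link k p Q c r c \<longleftrightarrow> k \<le> c \<and> c < p \<and> r = Max (Q c)"
  using successive_less[of c r c] Min_Max_Q_less[of c] by (auto simp: link_def)

lemma link_jump:
  "r < k \<Longrightarrow> r' < k \<Longrightarrow> link k p Q c r r' \<longleftrightarrow> k \<le> c \<and> c < p \<and> successive (Q c) r r'"
  by (auto simp: link_def)

lemma arc_iff:
  "arc u v \<longleftrightarrow>
     R u < k \<and> R v = R u \<and> Y v = Y u \<and> X v = X u + 1
   \<or> R u < k \<and> R v = R u \<and> Y u = 0 \<and> Y v = 1 \<and> X v = X u
   \<or> R u < k \<and> R v = R u \<and> Y u = 0 \<and> Y v = 1 \<and> X u mod p = 0 \<and> X v = X u + p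
   \<or> Y u = 0 \<and> X u = 0 \<and> Y v = 0 \<and> X v mod p = R u \<and> k \<le> R u \<and> R u < p \<and> R v = Min (Q (R u))
   \<or> Y u = 1 \<and> Y v = 1 \<and> X v = n * p \<and> X u mod p = R v \<and> k \<le> R v \<and> R v < p \<and> R u = Max (Q (R v))
   \<or> R u < k \<and> R v < k \<and> Y u = 1 \<and> Y v = 0 \<and> X v mod p = X u mod p \<and>
       link k p Q (X u mod p) (R u) (R v) \<and> E (R u * n + X u div p) (R v * n + X v div p)"
  unfolding gadget_arc_def Let_def L_def[symmetric] link_enter link_leave ..

lemma arc_cases [consumes 1, case_names step rung skip enter leave jump]:
  assumes "arc u v"
  obtains
    "R u < k" "R v = R u" "Y v = Y u" "X v = X u + 1"
  | "R u < k" "R v = R u" "Y u = 0" "Y v = 1" "X v = X u"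
  | "R u < k" "R v = R u" "Y u = 0" "Y v = 1" "X u mod p = 0" "X v = X u + p"
  | "k \<le> R u" "R u < p" "R v = Min (Q (R u))" "R v < k" "Y u = 0" "X u = 0" "Y v = 0" "X v mod p = R u"
  | "k \<le> R v" "R v < p" "R u = Max (Q (R v))" "R u < k" "Y u = 1" "Y v = 1" "X v = n * p"
    "X u mod p = R v"
  | "k \<le> X u mod p" "X u mod p < p" "successive (Q (X u mod p)) (R u) (R v)" "R u < R v" "R v < k"
    "Y u = 1" "Y v = 0" "X v mod p = X u mod p" "E (R u * n + X u div p) (R v * n + X v div p)"
proof -
  have p: "X u mod p < p" using k_less_p by simp
  from assms show ?thesis
    unfolding arc_iff
  proof (elim disjE conjE, goal_cases)
    case 1 then show ?case by (rule that(1))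
  next
    case 2 then show ?case by (rule that(2))
  next
    case 3 then show ?case by (rule that(3))
  next
    case 4 then show ?case using Min_Max_Q_less[of "R u"] that(4) by simp
  next
    case 5 then show ?case using Min_Max_Q_less[of "R v"] that(5) by simp
  next
    case 6 then show ?case
      using link_jump[of "R u" "R v"] that(6) p by (simp add: successive_def)
  qed
qed

lemma arcs_H: "(u, v) \<in> parcs H \<longleftrightarrow> u < N \<and> v < N \<and> arc u v"
  by (simp add: gadget_graph_def Let_def L_def)

lemma verts_H: "pverts H = {..<N}"
  by (simp add: gadget_graph_def Let_def L_def)

text \<open>Orders by row, then position, then layer, with the sources of the crossers before and
  their sinks after everything else. The factor 2 at the position makes room for the layer, so that
  rungs rise as well.\<close>

definition rank :: "nat \<Rightarrow> nat" where
  "rank u = (if R u < k then 1 + (R u * 2 * L + 2 * X u + Y u) else if Y u = 0 then 0 else 1 + k * 2 * L)"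

lemma rank_row_mono:
  assumes "r < r'" "x \<le> n * p" "l < 2"
  shows "r * 2 * L + 2 * x + l < r' * 2 * L"
proof -
  have "Suc r * (2 * L) \<le> r' * (2 * L)" using assms(1) by (intro mult_le_mono1) simp
  moreover have "2 * x + l < 2 * L" using assms(2,3) less_L_iff[of x] by simp
  ultimately show ?thesis by (simp add: mult.assoc)
qed

lemma rank_arc:
  assumes "arc u v"
  shows "rank u < rank v"
  using assms
proof (cases rule: arc_cases)
  case leave
  then show ?thesis using rank_row_mono[of "R u" k "X u" "Y u"] pos_le[of u] by (simp add: rank_def)
next
  case jump
  then show ?thesis using rank_row_mono[of "R u" "R v" "X u" "Y u"] pos_le[of u] by (simp add: rank_def)
qed (use k_less_p in \<open>auto simp: rank_def\<close>)

lemma rank_arcs: "e \<in> arcs (with_proj H) \<Longrightarrow> rank (tail (with_proj H) e) < rank (head (with_proj H) e)"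
  by (cases e) (simp add: arcs_H rank_arc )

lemma dag_H: "dag (with_proj H)"
  by (rule H.ranked_dag[where f = rank, OF rank_arcs])

text \<open>The rank grows along walks, so a path that has jumped to a later row or entered a sink
  cannot come back. This keeps row paths in their rows.\<close>

lemma awalk_to_row:
  assumes "H.awalk u q (t i)" "i < k"
  shows "R u < k \<Longrightarrow> R u \<le> i" and "\<not> R u < k \<Longrightarrow> Y u = 0"
proof -
  have *: "rank u \<le> rank (t i)"
    using H.awalk_rank_le[where f = rank, OF rank_arcs assms(1)] by simp
  { assume "R u < k" show "R u \<le> i"
    proof (rule ccontr)
      assume "\<not> R u \<le> i"
      with rank_row_mono[of i "R u" "n * p" 1] * \<open>R u < k\<close> assms(2) show False by (simp add: rank_def)
    qed }
  assume "\<not> R u < k"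
  with rank_row_mono[of i k "n * p" 1] * assms(2) show "Y u = 0"
    by (auto simp: rank_def split: if_splits)
qed

lemma no_arc_from_sink: "k \<le> R u \<Longrightarrow> Y u = 1 \<Longrightarrow> \<not> arc u v"
proof
  assume "k \<le> R u" "Y u = 1" "arc u v"
  from this(3) show False by (cases rule: arc_cases) (use \<open>k \<le> R u\<close> \<open>Y u = 1\<close> in auto)
qed

lemma awalk_from_sink:
  assumes "H.awalk u q w" "k \<le> R u" "Y u = 1"
  shows "u = w"
proof (cases q)
  case (Cons e q')
  with assms(1) have "arc u (snd e)"
    using arcs_H[of "fst e" "snd e"] by (simp add: H.awalk_Cons_iff)
  with no_arc_from_sink[OF assms(2,3)] show ?thesis by blast
qed (use assms in \<open>simp add: H.awalk_Nil_iff\<close>)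


subsection \<open>Disjoint paths yield a clique\<close>

lemma awalk_Cons_arc:
  "H.awalk u (e # q) w \<longleftrightarrow> fst e = u \<and> u < N \<and> snd e < N \<and> arc u (snd e) \<and> H.awalk (snd e) q w"
  by (cases e) (auto simp: H.awalk_Cons_iff arcs_H)

text \<open>Every arc from the lower line other than a step leads to a later row or a sink, from
  where \<open>t i\<close> is out of reach.\<close>

lemma lower_layer_visited:
  assumes "H.awalk u q (t i)" "i < k" "R u = i" "Y u = 1" "X u \<le> y" "y \<le> n * p"
  shows "nd i 1 y \<in> set (H.awalk_verts u q)"
  using assms
proof (induction q arbitrary: u)
  case Nil
  then have "u = t i" by (simp add: H.awalk_Nil_iff)
  with Nil.prems show ?case by simp
next
  case (Cons e q)
  then have e: "arc u (snd e)" "H.awalk (snd e) q (t i)" "fst e = u"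
    by (auto simp: awalk_Cons_arc)
  show ?case
  proof (cases "y = X u")
    case True
    with Cons.prems e(3) node_of_coords[of u] show ?thesis by simp
  next
    case False
    from e(1) show ?thesis
    proof (cases rule: arc_cases)
      case step
      with Cons False e show ?thesis by simp
    next
      case leave
      with awalk_to_row[OF e(2) \<open>i < k\<close>] show ?thesis by simp
    next
      case jump
      with awalk_to_row[OF e(2) \<open>i < k\<close>] Cons.prems show ?thesis by simp
    qed (use Cons.prems in auto)
  qed
qed

text \<open>The path visits every upper position before its change of line and every lower one after
  it. A skip starts and lands on block borders, so it frees just the block between; a rung leaves no
  position free on both lines, and naming the block around it is harmless.\<close>

lemma row_path_skips_block:
  assumes "H.awalk u q (t i)" "i < k" "R u = i" "Y u = 0"
  shows "\<exists>b<n. (\<forall>y. X u \<le> y \<and> y \<le> b * p \<longrightarrow> nd i 0 y \<in> set (H.awalk_verts u q)) \<and>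
               (\<forall>y. (b + 1) * p \<le> y \<and> y \<le> n * p \<longrightarrow> nd i 1 y \<in> set (H.awalk_verts u q))"
  using assms
proof (induction q arbitrary: u)
  case Nil
  then have "u = t i" by (simp add: H.awalk_Nil_iff)
  with Nil.prems show ?case by simp
next
  case (Cons e q)
  then have e: "arc u (snd e)" "H.awalk (snd e) q (t i)" "fst e = u"
    by (auto simp: awalk_Cons_arc)
  let ?V = "set (H.awalk_verts u (e # q))"
  have u: "nd i 0 (X u) \<in> ?V" using Cons.prems e(3) node_of_coords[of u] by simp
  have low: "nd i 1 y \<in> ?V" if "R (snd e) = i" "Y (snd e) = 1" "X (snd e) \<le> y" "y \<le> n * p" for y
    using lower_layer_visited[OF e(2) \<open>i < k\<close> that] by simp
  from e(1) show ?case
  proof (cases rule: arc_cases)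
    case step
    with Cons.IH[OF e(2) \<open>i < k\<close>] Cons.prems obtain b where b: "b < n"
      "\<And>y. X u + 1 \<le> y \<Longrightarrow> y \<le> b * p \<Longrightarrow> nd i 0 y \<in> set (H.awalk_verts (snd e) q)"
      "\<And>y. (b + 1) * p \<le> y \<Longrightarrow> y \<le> n * p \<Longrightarrow> nd i 1 y \<in> set (H.awalk_verts (snd e) q)"
      by auto
    have "nd i 0 y \<in> ?V" if "X u \<le> y" "y \<le> b * p" for y
      using b(2)[of y] that u by (cases "y = X u") auto
    with b(1,3) show ?thesis by auto
  next
    case rung
    \<comment> \<open>At the last position \<open>X u = n * p\<close> the quotient is
      \<open>n\<close>, hence the cap at \<open>n - 1\<close>.\<close>
    define b where "b = min (X u div p) (n - 1)"
    have p: "0 < p" using k_less_p by simp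
    have "b * p \<le> X u"
      using div_times_less_eq_dividend[of "X u" p] mult_le_mono1[of b "X u div p" p]
      unfolding b_def by linarith
    moreover have "X u \<le> (b + 1) * p"
    proof (cases "X u div p \<le> n - 1")
      case True
      then show ?thesis
        using dividend_less_div_times[OF p, of "X u"] by (simp add: b_def algebra_simps)
    next
      case False
      then show ?thesis using pos_le[of u] n_pos by (simp add: b_def)
    qed
    moreover have "b < n" using n_pos by (simp add: b_def)
    moreover have "nd i 0 y \<in> ?V" if "X u \<le> y" "y \<le> b * p" for y
    proof -
      have "y = X u" using that \<open>b * p \<le> X u\<close> by simp
      with u show ?thesis by simp
    qed
    ultimately show ?thesis using low rung Cons.prems
      by (intro exI[of _ b]) (auto simp del: H.awalk_verts.simps)
  next
    case skip
    define b where "b = X u div p"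
    have p: "0 < p" using k_less_p by simp
    have x: "X u = b * p" using skip by (auto simp: b_def)
    have "b * p < n * p" using pos_le[of "snd e"] skip(6) x p by linarith
    then have "b < n" by simp
    moreover have "nd i 0 y \<in> ?V" if "X u \<le> y" "y \<le> b * p" for y
    proof -
      have "y = X u" using that x by simp
      with u show ?thesis by simp
    qed
    ultimately show ?thesis using low skip Cons.prems x
      by (intro exI[of _ b]) (auto simp del: H.awalk_verts.simps)
  qed (use Cons.prems in auto)
qed

section \<open>Crossers that avoid a blocked set \<open>B\<close> leaving at most block
  \<open>b i\<close> of row \<open>i\<close> open\<close>

context
  fixes B :: "nat set" and b :: "nat \<Rightarrow> nat"
  assumes b_less: "\<And>i. i < k \<Longrightarrow> b i < n"
    and upper_blocked: "\<And>i y. i < k \<Longrightarrow> y \<le> b i * p \<Longrightarrow> nd i 0 y \<in> B"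
    and lower_blocked: "\<And>i y. i < k \<Longrightarrow> (b i + 1) * p \<le> y \<Longrightarrow> y \<le> n * p \<Longrightarrow> nd i 1 y \<in> B"
begin

lemma upper_unblocked: "u \<notin> B \<Longrightarrow> R u < k \<Longrightarrow> Y u = 0 \<Longrightarrow> b (R u) * p < X u"
  using upper_blocked[of "R u" "X u"] node_of_coords[of u] by (metis not_le)

lemma lower_unblocked: "u \<notin> B \<Longrightarrow> R u < k \<Longrightarrow> Y u = 1 \<Longrightarrow> X u < (b (R u) + 1) * p"
  using lower_blocked[of "R u" "X u"] node_of_coords[of u] pos_le[of u] by (metis not_le)

text \<open>To the right of the selected block the whole lower line is blocked, so only steps along
  the upper line remain. They never leave the row, and \<open>t c\<close> is not on an upper
  line.\<close>

lemma stuck_beyond_block: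
  assumes "H.awalk u q (t c)" "R u < k" "Y u = 0" "(b (R u) + 1) * p \<le> X u"
    "\<And>x. x \<in> set (H.awalk_verts u q) \<Longrightarrow> R x < k \<Longrightarrow> x \<notin> B"
  shows False
  using assms
proof (induction q arbitrary: u)
  case Nil
  then have "u = t c" by (simp add: H.awalk_Nil_iff)
  with Nil.prems show ?case by simp
next
  case (Cons e q)
  then have e: "arc u (snd e)" "H.awalk (snd e) q (t c)" "fst e = u"
    by (auto simp: awalk_Cons_arc)
  have free: "x \<notin> B" if "x \<in> set (H.awalk_verts (snd e) q)" "R x < k" for x
    using Cons.prems(5) that by simp
  then have free_head: "R (snd e) < k \<Longrightarrow> snd e \<notin> B"
    using H.hd_in_awalk_verts(1)[OF e(2)] by blast
  from e(1) show ?case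
  proof (cases rule: arc_cases)
    case step
    with Cons.IH[OF e(2)] Cons.prems free show ?thesis by simp
  qed (use Cons.prems lower_unblocked[of "snd e"] free_head in auto)
qed

text \<open>Inside the blocks steps raise the column, rungs and jumps keep it, and the last arc must
  start in column \<open>c\<close>. A crosser in column \<open>c\<close> thus cannot step any more,
  and each of its jumps tests the next pair of \<open>Q c\<close>.\<close>

lemma crosser_stays_in_blocks:
  assumes "H.awalk u q (t c)" "k \<le> c" "c < p" "R u < k" "b (R u) * p < X u" "X u < (b (R u) + 1) * p"
    "\<And>x. x \<in> set (H.awalk_verts u q) \<Longrightarrow> R x < k \<Longrightarrow> x \<notin> B"
  shows "X u mod p \<le> c \<and> (X u mod p = c \<longrightarrow>
    (\<forall>r r'. R u \<le> r \<and> successive (Q c) r r' \<longrightarrow> E (r * n + b r) (r' * n + b r')))"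
  using assms
proof (induction q arbitrary: u)
  case Nil
  then have "u = t c" by (simp add: H.awalk_Nil_iff)
  with Nil.prems show ?case by simp
next
  case (Cons e q)
  then have e: "arc u (snd e)" "H.awalk (snd e) q (t c)" "fst e = u"
    by (auto simp: awalk_Cons_arc)
  have free: "x \<notin> B" if "x \<in> set (H.awalk_verts (snd e) q)" "R x < k" for x
    using Cons.prems(7) that by simp
  then have free_head: "R (snd e) < k \<Longrightarrow> snd e \<notin> B"
    using H.hd_in_awalk_verts(1)[OF e(2)] by blast
  have p: "0 < p" using k_less_p by simp
  have block: "x div p = m" "x mod p = x - m * p" if "m * p < x" "x < (m + 1) * p" for x m
  proof -
    show "x div p = m"
      using that by (intro div_nat_eqI) (auto simp: mult.commute)
    then show "x mod p = x - m * p" by (simp add: minus_div_mult_eq_mod[symmetric])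
  qed
  note u = block[OF Cons.prems(5,6)]
  note IH = Cons.IH[OF e(2) Cons.prems(2,3) _ _ _ free]
  \<comment> \<open>On the lower line positions beyond the block are blocked; on the upper line they
    are dead ends.\<close>
  have below: "X (snd e) < (b (R (snd e)) + 1) * p" if "R (snd e) < k"
    using stuck_beyond_block[OF e(2) that _ _ free] lower_unblocked[of "snd e"] free_head that
      layer_cases[of "snd e"] by (cases "Y (snd e) = 0") (auto simp: not_le[symmetric])
  from e(1) show ?case
  proof (cases rule: arc_cases)
    case step
    then have r: "b (R (snd e)) * p < X (snd e)" "X (snd e) < (b (R (snd e)) + 1) * p"
      using Cons.prems(5) below Cons.prems(4) by auto
    \<comment> \<open>The step stays inside the block, so the column does not wrap around. The
      induction hypothesis for the larger column then excludes that \<open>u\<close> is in column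
      \<open>c\<close>.\<close>
    have "X (snd e) mod p = X u mod p + 1"
      using block(2)[OF r] u(2) Cons.prems(5) step by simp
    with IH[OF _ r] Cons.prems(4) step(2) show ?thesis by simp
  next
    case rung
    with IH Cons.prems(4-6) show ?thesis by simp
  next
    case skip
    with u(2) Cons.prems(5) show ?thesis by simp
  next
    case enter
    with Cons.prems(4) show ?thesis by simp
  next
    case leave
    with awalk_from_sink[OF e(2)] have "snd e = t c" by simp
    then have c: "R (snd e) = c" by simp
    \<comment> \<open>The crosser leaves from the last row of \<open>Q c\<close>, so no pair remains
      to be tested.\<close>
    have "\<not> (R u \<le> r \<and> successive (Q c) r r')" for r r'
    proof
      assume "R u \<le> r \<and> successive (Q c) r r'"
      then have "r' \<in> Q c" "Max (Q c) < r'" using leave c by (auto simp: successive_def)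
      with Max_ge[OF finite_Q[OF Cons.prems(2,3)]] show False by fastforce
    qed
    with leave c show ?thesis by auto
  next
    case jump
    then have head: "R (snd e) < k" "X (snd e) mod p = X u mod p" by auto
    have r: "b (R (snd e)) * p < X (snd e)" "X (snd e) < (b (R (snd e)) + 1) * p"
      using upper_unblocked[OF free_head[OF head(1)] head(1)] jump below[OF head(1)] by auto
    have IH': "X u mod p \<le> c"
      "X u mod p = c \<Longrightarrow> R (snd e) \<le> r \<Longrightarrow> successive (Q c) r r' \<Longrightarrow> E (r * n + b r) (r' * n + b r')" for r r'
      using IH[OF head(1) r] head(2) by auto
    \<comment> \<open>No member of \<open>Q c\<close> lies between \<open>R u\<close> and
      \<open>R (snd e)\<close>, so the only pair missing from the induction hypothesis is the one
      whose edge this jump encodes.\<close>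
    have "E (r * n + b r) (r' * n + b r')"
      if "X u mod p = c" "R u \<le> r" "successive (Q c) r r'" for r r'
    proof (cases "R (snd e) \<le> r")
      case False
      have succ: "successive (Q c) (R u) (R (snd e))" using jump(3) that(1) by simp
      with that(2,3) False have "r = R u"
        unfolding successive_def by (metis disjoint_iff greaterThanLessThan_iff le_neq_implies_less not_le)
      moreover from this succ that(3) have "r' = R (snd e)"
        unfolding successive_def by (metis disjoint_iff greaterThanLessThan_iff linorder_neqE_nat)
      ultimately show ?thesis using jump(9) u(1) block(1)[OF r] by simp
    qed (use IH' that in auto)
    with IH'(1) show ?thesis by auto
  qed
qed

lemma crosser_checks_edges:
  assumes "H.awalk (s c) q (t c)" "k \<le> c" "c < p" "successive (Q c) r r'"
    "\<And>x. x \<in> set (H.awalk_verts (s c) q) \<Longrightarrow> R x < k \<Longrightarrow> x \<notin> B"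
  shows "E (r * n + b r) (r' * n + b r')"
proof (cases q)
  case Nil
  with assms(1) have "Y (s c) = Y (t c)" by (simp add: H.awalk_Nil_iff)
  then show ?thesis by simp
next
  case (Cons e q')
  with assms(1) have e: "arc (s c) (snd e)" "H.awalk (snd e) q' (t c)" "fst e = s c"
    by (auto simp: awalk_Cons_arc)
  have free: "x \<notin> B" if "x \<in> set (H.awalk_verts (snd e) q')" "R x < k" for x
    using assms(5) that Cons by simp
  from e(1) show ?thesis
  proof (cases rule: arc_cases)
    case enter
    then have head: "R (snd e) = Min (Q c)" "R (snd e) < k" "Y (snd e) = 0" "X (snd e) mod p = c"
      by auto
    have "snd e \<notin> B" using free[OF H.hd_in_awalk_verts(1)[OF e(2)] head(2)] .
    then have lb: "b (R (snd e)) * p < X (snd e)" using upper_unblocked head(2,3) by blast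
    have ub: "X (snd e) < (b (R (snd e)) + 1) * p"
      using stuck_beyond_block[OF e(2) head(2,3) _ free] by (auto simp: not_le[symmetric])
    have "R (snd e) \<le> r"
      using assms(4) finite_Q[OF assms(2,3)] by (simp add: head(1) successive_def)
    then show ?thesis
      using crosser_stays_in_blocks[OF e(2) assms(2,3) head(2) lb ub free] head(4) assms(4) by blast
  qed (use assms(2) in auto)
qed

end

lemma disjoint_paths_imp_selection:
  assumes "disjoint_paths (with_proj H) p s t"
  shows "\<exists>b. (\<forall>i<k. b i < n) \<and> (\<forall>i j. i < j \<and> j < k \<longrightarrow> E (i * n + b i) (j * n + b j))"
proof -
  from assms obtain P where path: "\<And>i. i < p \<Longrightarrow> H.apath (s i) (P i) (t i)"
    and disj: "internally_disjoint (with_proj H) p s P"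
    unfolding disjoint_paths_def by blast
  have walk: "H.awalk (s i) (P i) (t i)" if "i < p" for i
    using path[OF that] by (rule H.awalkI_apath)
  let ?V = "\<lambda>i. set (H.awalk_verts (s i) (P i))"
  have "\<exists>b<n. (\<forall>y. y \<le> b * p \<longrightarrow> nd i 0 y \<in> ?V i) \<and>
      (\<forall>y. (b + 1) * p \<le> y \<and> y \<le> n * p \<longrightarrow> nd i 1 y \<in> ?V i)" if "i < k" for i
    using row_path_skips_block[OF walk that] that k_less_p by simp
  then obtain b where b: "\<And>i. i < k \<Longrightarrow> b i < n"
    "\<And>i y. i < k \<Longrightarrow> y \<le> b i * p \<Longrightarrow> nd i 0 y \<in> ?V i"
    "\<And>i y. i < k \<Longrightarrow> (b i + 1) * p \<le> y \<Longrightarrow> y \<le> n * p \<Longrightarrow> nd i 1 y \<in> ?V i"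
    by metis
  let ?B = "\<Union>i<k. ?V i"
  \<comment> \<open>Both ends of a crosser lie in its own row \<open>c\<close>, so all its vertices
    in rows below \<open>k\<close> are inner ones and have to avoid the row paths.\<close>
  have free: "x \<notin> ?B" if "k \<le> c" "c < p" "x \<in> ?V c" "R x < k" for c x
  proof
    assume "x \<in> ?B"
    then obtain i where i: "i < k" "x \<in> ?V i" by blast
    have "x \<noteq> s c" "x \<noteq> t c" using that by auto
    with that(3) have "x \<in> set (H.inner_verts (P c))"
      using H.set_inner_verts[OF path[OF that(2)]] by simp
    moreover have "c \<noteq> i" "i < p" using i that by auto
    then have "set (H.inner_verts (P c)) \<inter> ?V i = {}"
      using disj that(2) unfolding internally_disjoint_def by simp
    ultimately show False using i(2) by blast
  qed
  have "E (i * n + b i) (j * n + b j)" if ij: "i < j" "j < k" for i j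
  proof -
    obtain c where c: "k \<le> c" "c < p" "successive (Q c) i j" using Q_cover[OF ij] by blast
    have up: "nd r 0 y \<in> ?B" if "r < k" "y \<le> b r * p" for r y
      using b(2) that by blast
    have low: "nd r 1 y \<in> ?B" if "r < k" "(b r + 1) * p \<le> y" "y \<le> n * p" for r y
      using b(3) that by blast
    show ?thesis
      by (rule crosser_checks_edges[of b ?B, OF b(1) up low walk[OF c(2)] c free[OF c(1,2)]])
  qed
  with b(1) show ?thesis by blast
qed

subsection \<open>A clique yields disjoint shortest paths\<close>

text \<open>Hides the arc list: only the visited region, for disjointness, and the length, for
  minimality, matter below.\<close>

definition walk_in :: "nat set \<Rightarrow> nat \<Rightarrow> nat \<Rightarrow> nat \<Rightarrow> bool" where
  "walk_in V u w m \<longleftrightarrow> (\<exists>q. H.awalk u q w \<and> set (H.awalk_verts u q) \<subseteq> V \<and> length q = m)"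

lemma walk_in_refl: "u \<in> V \<Longrightarrow> u < N \<Longrightarrow> walk_in V u u 0"
  unfolding walk_in_def by (rule exI[of _ "[]"]) (simp add: H.awalk_Nil_iff verts_H)

lemma walk_in_step:
  assumes "walk_in V v w m" "arc u v" "u \<in> V" "u < N"
  shows "walk_in V u w (Suc m)"
proof -
  from assms(1) obtain q where q: "H.awalk v q w" "set (H.awalk_verts v q) \<subseteq> V" "length q = m"
    unfolding walk_in_def by blast
  then have "v < N" using H.awalk_hd_in_verts[OF q(1)] by (simp add: verts_H)
  with q assms show ?thesis
    unfolding walk_in_def by (intro exI[of _ "(u, v) # q"]) (simp add: awalk_Cons_arc)
qed

lemma lower_walk:
  assumes "i < k" "x \<le> n * p" "\<And>y. x \<le> y \<Longrightarrow> y \<le> n * p \<Longrightarrow> nd i 1 y \<in> V"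
  shows "walk_in V (nd i 1 x) (t i) (n * p - x)"
  using assms(2,3)
proof (induction "n * p - x" arbitrary: x)
  case 0
  then have "x = n * p" by simp
  with 0 show ?case using node_less[of i 1 x] assms(1) k_less_p by (simp add: walk_in_refl)
next
  case (Suc m)
  have "walk_in V (nd i 1 (x + 1)) (t i) (n * p - (x + 1))"
    using Suc(2-) by (intro Suc(1)) auto
  moreover have "arc (nd i 1 x) (nd i 1 (x + 1))"
    using Suc(2) assms(1) unfolding arc_iff by simp
  ultimately have "walk_in V (nd i 1 x) (t i) (Suc (n * p - (x + 1)))"
    using Suc(3,4) node_less[of i 1 x] assms(1) k_less_p by (intro walk_in_step) auto
  with Suc(2) show ?case by (simp add: Suc_diff_Suc)
qed

lemma upper_walk:
  assumes "i < k" "b < n" "x \<le> b * p"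
    "\<And>y. x \<le> y \<Longrightarrow> y \<le> b * p \<Longrightarrow> nd i 0 y \<in> V"
    "\<And>y. (b + 1) * p \<le> y \<Longrightarrow> y \<le> n * p \<Longrightarrow> nd i 1 y \<in> V"
  shows "walk_in V (nd i 0 x) (t i) (Suc (b * p - x + (n * p - (b + 1) * p)))"
  using assms(3,4)
proof (induction "b * p - x" arbitrary: x)
  case 0
  then have x: "x = b * p" by simp
  have le: "(b + 1) * p \<le> n * p" using assms(2) by (intro mult_le_mono1) simp
  have "b * p \<le> n * p" using assms(2) by simp
  have "walk_in V (nd i 1 ((b + 1) * p)) (t i) (n * p - (b + 1) * p)"
    using le assms by (intro lower_walk) auto
  moreover have "arc (nd i 0 x) (nd i 1 ((b + 1) * p))"
    using le x assms(1,2) unfolding arc_iff by simp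
  ultimately have "walk_in V (nd i 0 x) (t i) (Suc (n * p - (b + 1) * p))"
    using 0(3)[of x] x node_less[of i 0 x] assms(1) k_less_p \<open>b * p \<le> n * p\<close>
    by (intro walk_in_step) auto
  with x show ?case by simp
next
  case (Suc m)
  have "b * p \<le> n * p" using assms(2) by (intro mult_le_mono1) simp
  with Suc(2) have sx: "Suc x \<le> n * p" by linarith
  have "walk_in V (nd i 0 (x + 1)) (t i) (Suc (b * p - (x + 1) + (n * p - (b + 1) * p)))"
    using Suc(2-) by (intro Suc(1)) auto
  moreover have "arc (nd i 0 x) (nd i 0 (x + 1))"
    using sx assms(1) unfolding arc_iff by simp
  ultimately have "walk_in V (nd i 0 x) (t i) (Suc (Suc (b * p - (x + 1) + (n * p - (b + 1) * p))))"
    by (rule walk_in_step) (use Suc(2,3,4) sx node_less[of i 0 x] assms(1) k_less_p in auto)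
  with Suc(2) show ?case by (simp add: Suc_diff_Suc)
qed

text \<open>Each row of \<open>Q c\<close> from \<open>r\<close> on costs two arcs, a rung followed
  by a jump or the final arc; the walk is built backwards from the last row.\<close>

lemma crosser_walk:
  assumes c: "k \<le> c" "c < p"
    and b: "\<And>i. i < k \<Longrightarrow> b i < n"
    and E: "\<And>i j. i < j \<Longrightarrow> j < k \<Longrightarrow> E (i * n + b i) (j * n + b j)"
    and V: "\<And>i l. i < k \<Longrightarrow> l < 2 \<Longrightarrow> nd i l (b i * p + c) \<in> V" "t c \<in> V"
    and r: "r \<in> Q c"
  shows "walk_in V (nd r 0 (b r * p + c)) (t c) (2 * card {y \<in> Q c. r \<le> y})"
  using r
proof (induction r rule: measure_induct_rule[of "\<lambda>r. k - r"])
  case (less r)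
  have pos: "b i * p + c < n * p" if "i < k" for i
  proof -
    have "Suc (b i) * p \<le> n * p" using b[OF that] by (intro mult_le_mono1) simp
    with c(2) show ?thesis by simp
  qed
  have r: "r < k" using Q_less[OF c less.prems] .
  have fin: "finite (Q c)" using finite_Q[OF c] .
  have lt: "nd i l (b i * p + c) < N" if "i < k" "l < 2" for i l
    using node_less[of i l "b i * p + c"] pos[OF that(1)] that k_less_p by simp
  \<comment> \<open>The missing arc is the rung of row \<open>r\<close>, which is prepended
    afterwards.\<close>
  have "walk_in V (nd r 1 (b r * p + c)) (t c) (2 * card {y \<in> Q c. r \<le> y} - 1)"
  proof (cases "r = Max (Q c)")
    case True
    have "{y \<in> Q c. r \<le> y} = {r}" using True fin less.prems by (auto intro!: antisym)
    moreover have "arc (nd r 1 (b r * p + c)) (t c)"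
      using c True r pos[OF r] unfolding arc_iff by simp
    then have "walk_in V (nd r 1 (b r * p + c)) (t c) (Suc 0)"
      using lt[OF r, of 1] V r node_less[of c 1 "n * p"] c(2) by (intro walk_in_step[OF walk_in_refl]) auto
    ultimately show ?thesis by simp
  next
    case False
    define r' where "r' = Min {y \<in> Q c. r < y}"
    have "{y \<in> Q c. r < y} \<noteq> {}"
      using False less.prems Max_ge[OF fin less.prems] Min_Max_Q(2)[OF c]
      by (auto simp: le_less)
    with fin have "r' \<in> {y \<in> Q c. r < y}" unfolding r'_def by (intro Min_in) auto
    then have r': "r' \<in> Q c" "r < r'" by auto
    have least: "r' \<le> y" if "y \<in> Q c" "r < y" for y
      unfolding r'_def using that fin by (intro Min_le) auto
    have succ: "successive (Q c) r r'"
      using r' less.prems least by (fastforce simp: successive_def)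
    have k': "r' < k" using Q_less[OF c r'(1)] .
    have "walk_in V (nd r' 0 (b r' * p + c)) (t c) (2 * card {y \<in> Q c. r' \<le> y})"
      using less.IH[of r'] r' k' r by simp
    moreover have "arc (nd r 1 (b r * p + c)) (nd r' 0 (b r' * p + c))"
      using c succ r k' pos[OF r] pos[OF k'] E[OF r'(2) k'] unfolding arc_iff
      by (simp add: link_jump)
    ultimately have "walk_in V (nd r 1 (b r * p + c)) (t c) (Suc (2 * card {y \<in> Q c. r' \<le> y}))"
      using lt[OF r, of 1] V(1) r by (intro walk_in_step) auto
    moreover have "{y \<in> Q c. r \<le> y} = insert r {y \<in> Q c. r' \<le> y}"
      using r' less.prems least by force
    ultimately show ?thesis using fin r' by simp
  qed
  moreover have "arc (nd r 0 (b r * p + c)) (nd r 1 (b r * p + c))"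
    using r pos[OF r] unfolding arc_iff by simp
  ultimately have "walk_in V (nd r 0 (b r * p + c)) (t c) (Suc (2 * card {y \<in> Q c. r \<le> y} - 1))"
    using lt[OF r, of 0] V(1) r by (intro walk_in_step) auto
  moreover have "0 < card {y \<in> Q c. r \<le> y}"
    using less.prems fin by (auto simp: card_gt_0_iff)
  ultimately show ?case by simp
qed


text \<open>The bonus \<open>p - 1\<close> on the upper line makes a skip worth exactly 1 and a rung
  a loss. Whatever precedes row \<open>i\<close> is valued above all of it, and whatever follows
  gets 0, so arcs into or out of the row never gain.\<close>

definition row_potential :: "nat \<Rightarrow> nat \<Rightarrow> nat" where
  "row_potential i u =
     (if R u = i then X u + (if Y u = 0 then p - 1 else 0)
      else if R u < i \<or> k \<le> R u \<and> Y u = 0 then n * p + p else 0)"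

lemma row_potential_arc:
  assumes "arc u v" "i < k"
  shows "row_potential i v \<le> row_potential i u + 1"
  using assms(1)
proof (cases rule: arc_cases)
  case step
  then show ?thesis using pos_le[of v] by (auto simp: row_potential_def)
next
  case rung
  then show ?thesis by (auto simp: row_potential_def)
next
  case skip
  then show ?thesis using k_less_p by (auto simp: row_potential_def)
next
  case enter
  then show ?thesis using pos_le[of v] assms(2) by (auto simp: row_potential_def)
next
  case leave
  then show ?thesis using assms(2) by (auto simp: row_potential_def)
next
  case jump
  then show ?thesis using pos_le[of v] assms(2) by (auto simp: row_potential_def)
qed

text \<open>
  A path that leaves column \<open>c\<close> needs \<open>p\<close> unit steps to come back to it, which is no shorter
  than crossing all rows of \<open>Q c\<close> without leaving the column; here \<open>2 * k \<le> p + 2\<close> enters.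
\<close>

definition crosser_potential :: "nat \<Rightarrow> nat \<Rightarrow> nat" where
  "crosser_potential c u =
     (if R u < k then
        (if X u mod p = c then (if R u \<in> Q c then 2 * card {y \<in> Q c. y < R u} else 0)
         else if X u mod p < c then X u mod p + p - c else X u mod p - c) + 1 + Y u
      else if Y u = 0 then (if R u = c then 0 else 2 * p + 4)
      else if R u = c then 2 * card (Q c) + 1 else 0)"

lemma crosser_potential_arc:
  assumes "arc u v" "k \<le> c" "c < p"
  shows "crosser_potential c v \<le> crosser_potential c u + 1"
proof -
  have p: "0 < p" using k_less_p by simp
  have fin: "finite (Q c)" using finite_Q assms(2,3) .
  \<comment> \<open>Needed for the step back into column \<open>c\<close>: the potential before it
    is \<open>p + Y u\<close>, and after it at most \<open>2 * (k - 1) + 1 + Y u\<close>.\<close>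
  have few: "2 * card {y \<in> Q c. y < r} \<le> p" if "r \<in> Q c" for r
  proof -
    have "card {y \<in> Q c. y < r} \<le> card {..<r}" by (intro card_mono) auto
    with Q_less[OF assms(2,3) that] two_k_le show ?thesis by simp
  qed
  have y: "Y w \<le> 1" for w using layer_cases[of w] by auto
  have m: "X w mod p < p" for w using p by simp
  from assms(1) show ?thesis
  proof (cases rule: arc_cases)
    case step
    have "X v mod p = (if Suc (X u mod p) = p then 0 else Suc (X u mod p))"
      using step by (simp add: mod_Suc)
    then show ?thesis
      using step few[of "R u"] m[of u] assms(2,3) k_pos by (auto simp: crosser_potential_def)
  next
    case rung
    then show ?thesis by (auto simp: crosser_potential_def)
  next
    case skip
    then have "X v mod p = X u mod p" by simp
    with skip show ?thesis using assms(2) k_pos by (auto simp: crosser_potential_def)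
  next
    case enter
    have "{y \<in> Q c. y < Min (Q c)} = {}" using fin Min_le by fastforce
    then have "card {y \<in> Q c. y < Min (Q c)} = 0" by simp
    with enter show ?thesis using few[of "R v"] y[of v] m[of v] assms(2,3)
      by (auto simp: crosser_potential_def)
  next
    case leave
    show ?thesis
    proof (cases "R v = c")
      case True
      have mx: "Max (Q c) \<in> Q c" using Min_Max_Q assms(2,3) by simp
      have "{y \<in> Q c. y < Max (Q c)} = Q c - {Max (Q c)}"
        using Max_ge[OF fin] by (auto simp: less_le)
      then have "card (Q c) = Suc (card {y \<in> Q c. y < Max (Q c)})"
        using mx fin by (simp only: card_Suc_Diff1)
      with True leave mx show ?thesis by (auto simp: crosser_potential_def)
    next
      case False
      with leave show ?thesis by (auto simp: crosser_potential_def)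
    qed
  next
    case jump
    show ?thesis
    proof (cases "X u mod p = c")
      case True
      with jump have succ: "successive (Q c) (R u) (R v)" by simp
      then have "{y \<in> Q c. y < R v} = insert (R u) {y \<in> Q c. y < R u}"
        by (force simp: successive_def)
      then have "card {y \<in> Q c. y < R v} = Suc (card {y \<in> Q c. y < R u})" using fin by simp
      with True jump succ show ?thesis by (auto simp: crosser_potential_def successive_def)
    next
      case False
      with jump show ?thesis by (auto simp: crosser_potential_def)
    qed
  qed
qed

definition lane :: "(nat \<Rightarrow> nat) \<Rightarrow> nat \<Rightarrow> nat set" where
  "lane b i =
     (if i < k then {u. R u = i \<and> (Y u = 0 \<and> X u \<le> b i * p \<or> Y u = 1 \<and> (b i + 1) * p \<le> X u)}
      else {u. R u = i \<or> R u < k \<and> X u = b (R u) * p + i})"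

text \<open>A crosser has \<open>0 < i < p\<close>, so its position \<open>b (R u) * p + i\<close>
  is strictly inside the block that the lane of that row omits. Crossers differ in their
  columns.\<close>

lemma lane_disjoint:
  assumes "i < p" "j < p" "i \<noteq> j"
  shows "lane b i \<inter> lane b j = {}"
proof -
  have crossing: "lane b i \<inter> lane b j = {}" if "i < k" "k \<le> j" "j < p" for i j
    using that k_pos by (auto simp: lane_def)
  show ?thesis
    using crossing[of i j] crossing[of j i] assms by (cases "i < k"; cases "j < k") (auto simp: lane_def)
qed

lemma shortest_path_in_lane:
  assumes b: "\<And>i. i < k \<Longrightarrow> b i < n"
    and E: "\<And>i j. i < j \<Longrightarrow> j < k \<Longrightarrow> E (i * n + b i) (j * n + b j)"
    and i: "i < p"
  shows "\<exists>q. shortest_path (with_proj H) unit_weight (s i) q (t i) \<and> set (H.awalk_verts (s i) q) \<subseteq> lane b i"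
proof -
  \<comment> \<open>The potential \<open>f\<close> certifies minimality: it rises by exactly the
    length of the walk.\<close>
  have shortest: ?thesis
    if "walk_in (lane b i) (s i) (t i) m" "\<And>u v. arc u v \<Longrightarrow> f v \<le> f u + 1" "f (t i) = f (s i) + m"
    for m and f :: "nat \<Rightarrow> nat"
  proof -
    from that(1) obtain q where q: "H.awalk (s i) q (t i)" "set (H.awalk_verts (s i) q) \<subseteq> lane b i"
      "length q = m" unfolding walk_in_def by blast
    have pot: "f (head (with_proj H) e) \<le> f (tail (with_proj H) e) + 1" if "e \<in> arcs (with_proj H)" for e
      using that \<open>\<And>u v. arc u v \<Longrightarrow> f v \<le> f u + 1\<close> by (cases e) (simp add: arcs_H)
    have "shortest_path (with_proj H) unit_weight (s i) q (t i)"
    proof (rule H.shortest_path_unit_weightI)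
      show "H.apath (s i) q (t i)"
        by (rule H.ranked_awalk_is_apath[where f = rank, OF rank_arcs q(1)])
      show "length q \<le> length q'" if "H.awalk (s i) q' (t i)" for q'
        using H.awalk_potential_le[where f = f, OF pot that] q(3) \<open>f (t i) = f (s i) + m\<close> by simp
    qed
    with q(2) show ?thesis by blast
  qed
  have p: "0 < p" using k_less_p by simp
  show ?thesis
  proof (cases "i < k")
    case True
    have le: "(b i + 1) * p \<le> n * p" using b[OF True] by (intro mult_le_mono1) simp
    have upper: "y \<le> n * p" if "y \<le> b i * p" for y
      using that le by (rule order_trans[OF _ order_trans[rotated]]) simp
    let ?m = "Suc (b i * p - 0 + (n * p - (b i + 1) * p))"
    show ?thesis
    proof (rule shortest)
      show "walk_in (lane b i) (s i) (t i) ?m"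
        using True b[OF True] upper by (intro upper_walk) (auto simp: lane_def)
      show "arc u v \<Longrightarrow> row_potential i v \<le> row_potential i u + 1" for u v
        using row_potential_arc True by blast
      show "row_potential i (t i) = row_potential i (s i) + ?m"
        using le p by (simp add: row_potential_def)
    qed
  next
    case False
    then have c: "k \<le> i" by simp
    define r where "r = Min (Q i)"
    have r: "r \<in> Q i" "r < k" using Min_Max_Q[OF c i] Min_Max_Q_less[OF c i] by (simp_all add: r_def)
    have "Suc (b r) * p \<le> n * p" using b[OF r(2)] by (intro mult_le_mono1) simp
    with i have x: "b r * p + i \<le> n * p" by simp
    have pos: "b j * p + i \<le> n * p" if "j < k" for j
    proof -
      have "Suc (b j) * p \<le> n * p" using b[OF that] by (intro mult_le_mono1) simp
      with i show ?thesis by simp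
    qed
    have "walk_in (lane b i) (nd r 0 (b r * p + i)) (t i) (2 * card {y \<in> Q i. r \<le> y})"
      using pos False by (intro crosser_walk[OF c i b E _ _ r(1)]) (auto simp: lane_def)
    moreover have "{y \<in> Q i. r \<le> y} = Q i" using finite_Q[OF c i] by (auto simp: r_def)
    ultimately have "walk_in (lane b i) (nd r 0 (b r * p + i)) (t i) (2 * card (Q i))" by simp
    moreover have "arc (s i) (nd r 0 (b r * p + i))"
      using c i x unfolding arc_iff by (simp add: r_def)
    ultimately have walk: "walk_in (lane b i) (s i) (t i) (Suc (2 * card (Q i)))"
      using False i node_less[of i 0 0] by (intro walk_in_step) (auto simp: lane_def)
    show ?thesis
    proof (rule shortest[OF walk])
      show "arc u v \<Longrightarrow> crosser_potential i v \<le> crosser_potential i u + 1" for u v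
        using crosser_potential_arc c i by blast
      show "crosser_potential i (t i) = crosser_potential i (s i) + Suc (2 * card (Q i))"
        using False by (simp add: crosser_potential_def)
    qed
  qed
qed

lemma selection_imp_disjoint_shortest_paths:
  assumes "\<And>i. i < k \<Longrightarrow> b i < n"
    and "\<And>i j. i < j \<Longrightarrow> j < k \<Longrightarrow> E (i * n + b i) (j * n + b j)"
  shows "disjoint_shortest_paths (with_proj H) unit_weight p s t"
proof -
  obtain P where P: "\<And>i. i < p \<Longrightarrow> shortest_path (with_proj H) unit_weight (s i) (P i) (t i)"
    "\<And>i. i < p \<Longrightarrow> set (H.awalk_verts (s i) (P i)) \<subseteq> lane b i"
    using shortest_path_in_lane[OF assms] by metis
  have "set (H.inner_verts (P i)) \<subseteq> lane b i" if "i < p" for i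
    using P[OF that] H.set_inner_verts[of "s i" "P i" "t i"] unfolding shortest_path_def by blast
  with P lane_disjoint show ?thesis
    unfolding disjoint_shortest_paths_def internally_disjoint_def by (intro exI[of _ P]) blast
qed

lemma disjoint_shortest_paths_imp_disjoint_paths:
  "disjoint_shortest_paths (with_proj H) unit_weight p s t \<Longrightarrow> disjoint_paths (with_proj H) p s t"
  unfolding disjoint_shortest_paths_def disjoint_paths_def shortest_path_def by blast

text \<open>Both equivalences come from one circle: a selection gives disjoint shortest paths, these
  are disjoint paths, and disjoint paths give a selection.\<close>

lemma disjoint_paths_iff_selection:
  "disjoint_paths (with_proj H) p s t \<longleftrightarrow>
     (\<exists>b. (\<forall>i<k. b i < n) \<and> (\<forall>i j. i < j \<and> j < k \<longrightarrow> E (i * n + b i) (j * n + b j)))"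
    (is "?dp \<longleftrightarrow> ?sel")
  and disjoint_shortest_paths_iff_selection:
  "disjoint_shortest_paths (with_proj H) unit_weight p s t \<longleftrightarrow>
     (\<exists>b. (\<forall>i<k. b i < n) \<and> (\<forall>i j. i < j \<and> j < k \<longrightarrow> E (i * n + b i) (j * n + b j)))"
    (is "?dsp \<longleftrightarrow> _")
proof -
  have "?dsp" if ?sel
  proof -
    from that obtain b where "\<forall>i<k. b i < n"
      "\<forall>i j. i < j \<and> j < k \<longrightarrow> E (i * n + b i) (j * n + b j)" by blast
    then show ?thesis by (intro selection_imp_disjoint_shortest_paths[of b]) simp_all
  qed
  then show "?dp \<longleftrightarrow> ?sel" "?dsp \<longleftrightarrow> ?sel"
    using disjoint_paths_imp_selection disjoint_shortest_paths_imp_disjoint_paths by argo+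
qed

end

section \<open>Programming the word RAM\<close>

abbreviation expr_or :: "expr \<Rightarrow> expr \<Rightarrow> expr" where
  "expr_or a b \<equiv> Op Less (Const 0) (Op Plus a b)"

abbreviation expr_and :: "expr \<Rightarrow> expr \<Rightarrow> expr" where
  "expr_and \<equiv> Op Times"

definition holds :: "nat \<Rightarrow> ram_state \<Rightarrow> expr \<Rightarrow> bool \<Rightarrow> bool" where
  "holds w \<sigma> e P \<longleftrightarrow> expr_val w \<sigma> e = of_bool P"

lemma word_gt: "2 \<le> w \<Longrightarrow> 2 < (2 :: nat) ^ w"
  using power_increasing[of 2 w "2 :: nat"] by simp

text \<open>
  The second conjunct is only constrained if the first one holds, as a product with \<open>0\<close> never
  overflows; this is what makes unguarded memory accesses harmless.
\<close>

lemma holds_and: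
  assumes "2 \<le> w" "holds w \<sigma> a P" "P \<Longrightarrow> holds w \<sigma> b P'"
  shows "holds w \<sigma> (expr_and a b) (P \<and> P')"
  using assms word_gt[of w] by (cases P) (auto simp: holds_def)

text \<open>The sum of two truth values may be 2, which must not overflow; hence
  \<open>2 \<le> w\<close>.\<close>

lemma holds_or:
  assumes "2 \<le> w" "holds w \<sigma> a P" "holds w \<sigma> b P'"
  shows "holds w \<sigma> (expr_or a b) (P \<or> P')"
  using assms word_gt[of w] by (cases P; cases P') (auto simp: holds_def)

lemma holds_equal:
  assumes "2 \<le> w" "expr_val w \<sigma> a = x" "expr_val w \<sigma> b = y"
  shows "holds w \<sigma> (Op Equal a b) (x = y)"
  using assms word_gt[of w] by (auto simp: holds_def)

lemma holds_less:
  assumes "2 \<le> w" "expr_val w \<sigma> a = x" "expr_val w \<sigma> b = y"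
  shows "holds w \<sigma> (Op Less a b) (x < y)"
  using assms word_gt[of w] by (auto simp: holds_def)

lemma expr_val_Plus:
  "expr_val w \<sigma> a = x \<Longrightarrow> expr_val w \<sigma> b = y \<Longrightarrow> x + y < 2 ^ w \<Longrightarrow> expr_val w \<sigma> (Op Plus a b) = x + y"
  by simp

lemma expr_val_Times:
  "expr_val w \<sigma> a = x \<Longrightarrow> expr_val w \<sigma> b = y \<Longrightarrow> x * y < 2 ^ w \<Longrightarrow> expr_val w \<sigma> (Op Times a b) = x * y"
  by simp

lemma expr_val_Quot:
  "expr_val w \<sigma> a = x \<Longrightarrow> expr_val w \<sigma> b = y \<Longrightarrow> x < 2 ^ w \<Longrightarrow> expr_val w \<sigma> (Op Quot a b) = x div y"
  using div_le_dividend[of x y] by (auto intro!: mod_less le_less_trans[OF div_le_dividend])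

lemma expr_val_Rem:
  "expr_val w \<sigma> a = x \<Longrightarrow> expr_val w \<sigma> b = y \<Longrightarrow> x < 2 ^ w \<Longrightarrow> expr_val w \<sigma> (Op Rem a b) = x mod y"
  by (auto intro!: mod_less le_less_trans[OF mod_less_eq_dividend])

lemma expr_val_Const: "c < 2 ^ w \<Longrightarrow> expr_val w \<sigma> (Const c) = c"
  by simp

text \<open>Makes a finite ternary relation part of the program text. It will hold
  \<open>link\<close>, which depends on \<open>k\<close> only, so a lookup takes constant
  time.\<close>

definition table_expr :: "(nat \<times> nat \<times> nat) list \<Rightarrow> expr \<Rightarrow> expr \<Rightarrow> expr \<Rightarrow> expr" where
  "table_expr ts a b c = foldr (\<lambda>(x, y, z) e. expr_or (expr_and (Op Equal a (Const x))
     (expr_and (Op Equal b (Const y)) (Op Equal c (Const z)))) e) ts (Const 0)"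

lemma holds_table:
  assumes "2 \<le> w" "expr_val w \<sigma> a = x" "expr_val w \<sigma> b = y" "expr_val w \<sigma> c = z"
    and "\<And>i j l. (i, j, l) \<in> set ts \<Longrightarrow> i < 2 ^ w \<and> j < 2 ^ w \<and> l < 2 ^ w"
  shows "holds w \<sigma> (table_expr ts a b c) ((x, y, z) \<in> set ts)"
  using assms(5)
proof (induction ts)
  case Nil
  then show ?case by (simp add: holds_def table_expr_def)
next
  case (Cons t ts)
  obtain i j l where t: "t = (i, j, l)" by (cases t) auto
  have "holds w \<sigma> (table_expr (t # ts) a b c) ((x = i \<and> y = j \<and> z = l) \<or> (x, y, z) \<in> set ts)"
    unfolding table_expr_def t foldr.simps comp_def prod.case
    unfolding table_expr_def[symmetric]
    using Cons.prems[of i j l] t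
    by (intro holds_or holds_and holds_equal assms expr_val_Const Cons.IH Cons.prems) auto
  moreover have "(x = i \<and> y = j \<and> z = l) \<or> (x, y, z) \<in> set ts \<longleftrightarrow> (x, y, z) \<in> set (t # ts)"
    using t by auto
  ultimately show ?case by simp
qed

definition fill_loop :: "nat \<Rightarrow> nat \<Rightarrow> expr \<Rightarrow> expr \<Rightarrow> prog" where
  "fill_loop i b bnd e = While (Op Less (Reg i) bnd)
     (Seq (Store (Op Plus (Reg b) (Reg i)) e) (SetReg i (Op Plus (Reg i) (Const 1))))"

definition filled :: "nat \<Rightarrow> nat \<Rightarrow> (nat \<Rightarrow> nat) \<Rightarrow> ram_state \<Rightarrow> nat \<Rightarrow> ram_state" where
  "filled i \<beta> g \<sigma> j = \<lparr>regs = (regs \<sigma>)(i := j),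
     mem = (\<lambda>a. if \<beta> \<le> a \<and> a < \<beta> + j then g (a - \<beta>) else mem \<sigma> a)\<rparr>"

text \<open>\<open>bnd\<close> and \<open>e\<close> are evaluated in the partially filled states
  because they may read the counter and the memory being written. A round costs
  \<open>expr_time bnd + 3\<close> for the test, \<open>expr_time e + 4\<close> for the store and 4
  for the increment.\<close>

lemma exec_fill_loop:
  assumes "0 < w" "b \<noteq> i" "regs \<sigma> b = \<beta>" "\<beta> + B < 2 ^ w"
    and bnd: "\<And>j. j \<le> B \<Longrightarrow> expr_val w (filled i \<beta> g \<sigma> j) bnd = B"
    and e: "\<And>j. j < B \<Longrightarrow> expr_val w (filled i \<beta> g \<sigma> j) e = g j"
    and "j \<le> B"
  shows "exec w (fill_loop i b bnd e) (filled i \<beta> g \<sigma> j)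
    ((B - j) * (expr_time bnd + expr_time e + 11) + expr_time bnd + 3) (filled i \<beta> g \<sigma> B)"
  using assms(7)
proof (induction "B - j" arbitrary: j)
  case 0
  then have j: "j = B" by simp
  have "expr_val w (filled i \<beta> g \<sigma> B) (Op Less (Reg i) bnd) = 0"
    using bnd[of B] by (simp add: filled_def)
  from exec_While_false[OF this] show ?case
    unfolding fill_loop_def j by (simp add: add.commute numeral_3_eq_3)
next
  case (Suc d)
  let ?\<sigma> = "filled i \<beta> g \<sigma>"
  let ?st = "Store (Op Plus (Reg b) (Reg i)) e" and ?inc = "SetReg i (Op Plus (Reg i) (Const 1))"
  have jB: "j < B" using Suc(2) by simp
  have w: "1 < (2 :: nat) ^ w" using power_increasing[of 1 w "2 :: nat"] assms(1) by simp
  have cond: "expr_val w (?\<sigma> j) (Op Less (Reg i) bnd) \<noteq> 0"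
    using bnd[of j] jB assms(1) by (simp add: filled_def)
  have "exec w ?st (?\<sigma> j) (expr_time (Op Plus (Reg b) (Reg i)) + expr_time e + 1)
     ((?\<sigma> j)\<lparr>mem := (mem (?\<sigma> j))(\<beta> + j := g j)\<rparr>)"
    using exec_Store[of w "Op Plus (Reg b) (Reg i)" e "?\<sigma> j"] e[OF jB] assms(2-4) jB
    by (simp add: filled_def)
  moreover have "exec w ?inc ((?\<sigma> j)\<lparr>mem := (mem (?\<sigma> j))(\<beta> + j := g j)\<rparr>) 4 (?\<sigma> (j + 1))"
  proof -
    have "((?\<sigma> j)\<lparr>mem := (mem (?\<sigma> j))(\<beta> + j := g j)\<rparr>)
        \<lparr>regs := (regs (?\<sigma> j))(i := j + 1)\<rparr> = ?\<sigma> (j + 1)"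
      by (auto simp: filled_def fun_eq_iff)
    with exec_SetReg[of w i "Op Plus (Reg i) (Const 1)" "(?\<sigma> j)\<lparr>mem := (mem (?\<sigma> j))(\<beta> + j := g j)\<rparr>"]
    show ?thesis using jB assms(1,4) by (simp add: filled_def eval_nat_numeral)
  qed
  ultimately have body: "exec w (Seq ?st ?inc) (?\<sigma> j)
      (expr_time (Op Plus (Reg b) (Reg i)) + expr_time e + 1 + 4) (?\<sigma> (j + 1))"
    by (rule exec_Seq)
  have "exec w (fill_loop i b bnd e) (?\<sigma> (j + 1))
      ((B - (j + 1)) * (expr_time bnd + expr_time e + 11) + expr_time bnd + 3) (?\<sigma> B)"
    using Suc(2) jB by (intro Suc(1)) auto
  from exec_While_true[OF cond body this[unfolded fill_loop_def]]
  have "exec w (fill_loop i b bnd e) (?\<sigma> j)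
     (expr_time (Op Less (Reg i) bnd) + 1 + (expr_time (Op Plus (Reg b) (Reg i)) + expr_time e + 1 + 4) +
      ((B - (j + 1)) * (expr_time bnd + expr_time e + 11) + expr_time bnd + 3)) (?\<sigma> B)"
    unfolding fill_loop_def .
  moreover have "B - j = Suc (B - (j + 1))" using jB by simp
  then have "(B - j) * (expr_time bnd + expr_time e + 11) + expr_time bnd + 3 =
     expr_time (Op Less (Reg i) bnd) + 1 + (expr_time (Op Plus (Reg b) (Reg i)) + expr_time e + 1 + 4) +
      ((B - (j + 1)) * (expr_time bnd + expr_time e + 11) + expr_time bnd + 3)"
    by simp
  ultimately show ?case by (simp only:)
qed

section \<open>The reduction as a program\<close>

abbreviation "row_expr e \<equiv> Op Quot (Op Quot e (Reg 4)) (Const 2)"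
abbreviation "layer_expr e \<equiv> Op Rem (Op Quot e (Reg 4)) (Const 2)"
abbreviation "pos_expr e \<equiv> Op Rem e (Reg 4)"

text \<open>Decides the matrix entry with flat index in register 5. Registers 0, 3 and 4 hold the
  number of vertices, \<open>n\<close> and the length of a line. The memory access comes last in its
  conjunction, where the other conjuncts guard it.\<close>

definition arc_expr :: "nat \<Rightarrow> nat \<Rightarrow> (nat \<times> nat \<times> nat) list \<Rightarrow> expr" where
  "arc_expr k p ts =
     (let u = Op Quot (Reg 5) (Reg 0); v = Op Rem (Reg 5) (Reg 0);
          r = row_expr u; l = layer_expr u; x = pos_expr u;
          r' = row_expr v; l' = layer_expr v; x' = pos_expr v;
          modp = (\<lambda>e. Op Rem e (Const p)); divp = (\<lambda>e. Op Quot e (Const p));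
          conj = (\<lambda>es. foldr expr_and es (Const 1));
          edge = Load (Op Plus
            (Op Times (Op Plus (Op Times r (Reg 3)) (divp x)) (Op Times (Const k) (Reg 3)))
            (Op Plus (Op Times r' (Reg 3)) (divp x')))
      in foldr expr_or
       [conj [Op Less r (Const k), Op Equal r' r, Op Equal l' l, Op Equal x' (Op Plus x (Const 1))],
        conj [Op Less r (Const k), Op Equal r' r, Op Equal l (Const 0), Op Equal l' (Const 1),
              Op Equal x' x],
        conj [Op Less r (Const k), Op Equal r' r, Op Equal l (Const 0), Op Equal l' (Const 1),
              Op Equal (modp x) (Const 0), Op Equal x' (Op Plus x (Const p))],
        conj [Op Equal l (Const 0), Op Equal x (Const 0), Op Equal l' (Const 0),
              Op Equal (modp x') r, table_expr ts r r r'],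
        conj [Op Equal l (Const 1), Op Equal l' (Const 1), Op Equal x' (Op Minus (Reg 4) (Const 1)),
              Op Equal (modp x) r', table_expr ts r' r r'],
        conj [Op Less r (Const k), Op Less r' (Const k), Op Equal l (Const 1), Op Equal l' (Const 0),
              Op Equal (modp x') (modp x), table_expr ts (modp x) r r', edge]] (Const 0))"

lemma holds_arc_expr:
  assumes w: "2 \<le> w"
    and "n * p + 1 = L" "0 < n" "0 < k" "k \<le> p"
    and regs: "regs \<sigma> 0 = N" "regs \<sigma> 3 = n" "regs \<sigma> 4 = L" "regs \<sigma> 5 = a"
    and bounds: "a < 2 ^ w" "L + p < 2 ^ w" "(k * n)\<^sup>2 < 2 ^ w"
    and ts: "\<And>c r r'. (c, r, r') \<in> set ts \<longleftrightarrow> lk c r r'"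
      "\<And>c r r'. lk c r r' \<Longrightarrow> 0 < c \<and> c \<le> p \<and> r \<le> p \<and> r' \<le> p"
    and E: "\<And>i j. i < k * n \<Longrightarrow> j < k * n \<Longrightarrow> mem \<sigma> (i * (k * n) + j) = of_bool (E i j)"
  shows "holds w \<sigma> (arc_expr k p ts) (gadget_arc k p n lk E (a div N) (a mod N))"
proof -
  let ?u = "Op Quot (Reg 5) (Reg 0)" and ?v = "Op Rem (Reg 5) (Reg 0)"
  define r l x r' l' x' where d: "r = row L (a div N)" "l = layer L (a div N)" "x = pos L (a div N)"
    "r' = row L (a mod N)" "l' = layer L (a mod N)" "x' = pos L (a mod N)"
  have p: "p < 2 ^ w" "k < 2 ^ w" using bounds(2) assms(5) by auto
  have two: "(2::nat) < 2 ^ w" "(1::nat) < 2 ^ w" "(0::nat) < 2 ^ w" using word_gt[OF w] by auto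
  have u: "expr_val w \<sigma> ?u = a div N" and v: "expr_val w \<sigma> ?v = a mod N"
    by (intro expr_val_Quot expr_val_Rem; simp add: regs bounds)+
  have uv: "a div N < 2 ^ w" "a mod N < 2 ^ w" "a div N div L < 2 ^ w" "a mod N div L < 2 ^ w"
    using bounds(1) by (auto intro: le_less_trans[OF div_le_dividend] le_less_trans[OF mod_less_eq_dividend])
  have coord: "expr_val w \<sigma> (row_expr ?u) = r" "expr_val w \<sigma> (layer_expr ?u) = l" "expr_val w \<sigma> (pos_expr ?u) = x"
    "expr_val w \<sigma> (row_expr ?v) = r'" "expr_val w \<sigma> (layer_expr ?v) = l'" "expr_val w \<sigma> (pos_expr ?v) = x'"
    unfolding d row_def layer_def pos_def
    by (intro expr_val_Quot expr_val_Rem expr_val_Const u v uv two; simp add: regs)+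
  have "x < L" "x' < L" using assms(2) by (auto simp: d pos_def)
  then have x: "x < 2 ^ w" "x' < 2 ^ w" "x + 1 < 2 ^ w" "x + p < 2 ^ w"
    using bounds(2) assms(4,5) by auto
  have mp: "expr_val w \<sigma> (Op Rem (pos_expr ?u) (Const p)) = x mod p"
    "expr_val w \<sigma> (Op Rem (pos_expr ?v) (Const p)) = x' mod p"
    "expr_val w \<sigma> (Op Quot (pos_expr ?u) (Const p)) = x div p"
    "expr_val w \<sigma> (Op Quot (pos_expr ?v) (Const p)) = x' div p"
    by (intro expr_val_Quot expr_val_Rem expr_val_Const coord x p)+
  have last: "expr_val w \<sigma> (Op Minus (Reg 4) (Const 1)) = n * p"
    using w two(2) bounds(2) by (simp add: regs assms(2)[symmetric])
  have tab: "(i, j, m) \<in> set ts \<Longrightarrow> i < 2 ^ w \<and> j < 2 ^ w \<and> m < 2 ^ w" for i j m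
    using ts p by fastforce
  have one: "holds w \<sigma> (Const 1) True" and zero: "holds w \<sigma> (Const 0) False"
    using two w by (auto simp: holds_def)
  have edge: "holds w \<sigma> (Load (Op Plus
            (Op Times (Op Plus (Op Times (row_expr ?u) (Reg 3)) (Op Quot (pos_expr ?u) (Const p)))
               (Op Times (Const k) (Reg 3)))
            (Op Plus (Op Times (row_expr ?v) (Reg 3)) (Op Quot (pos_expr ?v) (Const p)))))
       (E (r * n + x div p) (r' * n + x' div p))"
    if g: "r < k" "r' < k" "x' mod p = x mod p" "lk (x mod p) r r'"
  proof -
    have m0: "0 < x mod p" using ts(2)[OF g(4)] by simp
    \<comment> \<open>A nonzero column excludes the last position \<open>n * p\<close>, whose block
      number \<open>n\<close> would be out of range.\<close>
    have div: "y div p < n" if "y < L" "0 < y mod p" for y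
    proof -
      have "y \<noteq> n * p" using that(2) by auto
      with that(1) assms(2) have "y < n * p" by simp
      then show ?thesis using assms(4,5) by (simp add: div_less_iff_less_mult)
    qed
    have in_range: "i * n + j < k * n" if "i < k" "j < n" for i j
    proof -
      have "Suc i * n \<le> k * n" using that(1) by (intro mult_le_mono1) simp
      with that(2) show ?thesis by simp
    qed
    let ?i = "r * n + x div p" and ?j = "r' * n + x' div p"
    have i: "?i < k * n" using in_range[OF g(1) div[OF \<open>x < L\<close> m0]] .
    have j: "?j < k * n" using in_range[OF g(2) div[OF \<open>x' < L\<close>]] m0 g(3) by simp
    have "Suc ?i * (k * n) \<le> (k * n) * (k * n)" using i by (intro mult_le_mono1) simp
    with j have addr: "?i * (k * n) + ?j < (k * n)\<^sup>2" by (simp add: power2_eq_square)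
    have kn: "k * n \<le> (k * n)\<^sup>2" using assms(3,4) by (simp add: power2_eq_square)
    have r3: "expr_val w \<sigma> (Reg 3) = n" by (simp add: regs)
    have "expr_val w \<sigma> (Op Plus
            (Op Times (Op Plus (Op Times (row_expr ?u) (Reg 3)) (Op Quot (pos_expr ?u) (Const p)))
               (Op Times (Const k) (Reg 3)))
            (Op Plus (Op Times (row_expr ?v) (Reg 3)) (Op Quot (pos_expr ?v) (Const p)))) =
       ?i * (k * n) + ?j"
      by (intro expr_val_Plus expr_val_Times coord mp expr_val_Const p r3)
         (use i j addr kn bounds(3) in linarith)+
    then show ?thesis using E[OF i j] unfolding holds_def by (simp only: expr_val.simps(3))
  qed
  \<comment> \<open>The trailing \<open>True\<close> and \<open>False\<close> mirror the constants
    that end the folds.\<close>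
  have "holds w \<sigma> (arc_expr k p ts)
     ((r < k \<and> r' = r \<and> l' = l \<and> x' = x + 1 \<and> True)
    \<or> (r < k \<and> r' = r \<and> l = 0 \<and> l' = 1 \<and> x' = x \<and> True)
    \<or> (r < k \<and> r' = r \<and> l = 0 \<and> l' = 1 \<and> x mod p = 0 \<and> x' = x + p \<and> True)
    \<or> (l = 0 \<and> x = 0 \<and> l' = 0 \<and> x' mod p = r \<and> (r, r, r') \<in> set ts \<and> True)
    \<or> (l = 1 \<and> l' = 1 \<and> x' = n * p \<and> x mod p = r' \<and> (r', r, r') \<in> set ts \<and> True)
    \<or> (r < k \<and> r' < k \<and> l = 1 \<and> l' = 0 \<and> x' mod p = x mod p \<and> (x mod p, r, r') \<in> set ts \<and>
        E (r * n + x div p) (r' * n + x' div p) \<and> True) \<or> False)"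
    unfolding arc_expr_def Let_def list.case foldr.simps comp_def id_def
    by (intro holds_or[OF w] holds_and[OF w] holds_equal[OF w] holds_less[OF w] holds_table[OF w]
        one zero coord mp last expr_val_Const expr_val_Plus tab x p two edge; simp add: ts)
  then show ?thesis
    unfolding gadget_arc_def Let_def assms(2) d[symmetric] by (simp add: ts)
qed


text \<open>Register 0 must end up with the size of the output, so \<open>n\<close> is saved first.
  The output matrix starts right behind the input matrix, and the terminals behind both.\<close>

definition init_prog :: "nat \<Rightarrow> nat \<Rightarrow> prog" where
  "init_prog k p =
     Seq (SetReg 3 (Reg 0))
    (Seq (SetReg 4 (Op Plus (Op Times (Reg 3) (Const p)) (Const 1)))
    (Seq (SetReg 0 (Op Times (Const (2 * p)) (Reg 4)))
    (Seq (SetReg 1 (Op Times (Op Times (Const k) (Reg 3)) (Op Times (Const k) (Reg 3))))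
         (SetReg 2 (Op Plus (Reg 1) (Op Times (Reg 0) (Reg 0)))))))"

definition reduction_prog :: "nat \<Rightarrow> nat \<Rightarrow> (nat \<times> nat \<times> nat) list \<Rightarrow> prog" where
  "reduction_prog k p ts =
     Seq (init_prog k p)
    (Seq (fill_loop 5 1 (Op Times (Reg 0) (Reg 0)) (arc_expr k p ts))
         (fill_loop 6 2 (Const (2 * p)) (Op Plus (Op Times (Reg 6) (Reg 4))
            (Op Times (Op Rem (Reg 6) (Const 2)) (Op Minus (Reg 4) (Const 1))))))"

lemma exec_SetReg_value:
  "expr_val w \<sigma> e = x \<Longrightarrow> \<tau> = expr_time e + 1 \<Longrightarrow>
   exec w (SetReg r e) \<sigma> \<tau> \<lparr>regs = (regs \<sigma>)(r := x), mem = mem \<sigma>\<rparr>"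
  using exec_SetReg[of w r e \<sigma>] by (cases \<sigma>) simp

lemma filled_0: "regs \<sigma> i = 0 \<Longrightarrow> filled i \<beta> g \<sigma> 0 = \<sigma>"
  by (auto simp: filled_def intro!: ram_state.equality)

context
  fixes k p n w :: nat and L N :: nat
  assumes L: "L = n * p + 1" and N: "N = 2 * p * L"
    and w: "2 \<le> w" and n: "0 < n" and k: "0 < k" "k \<le> p"
    and word: "(k * n)\<^sup>2 + N\<^sup>2 + 2 * p < 2 ^ w"
begin

lemma size_bounds: "L + p < 2 ^ w" "N \<le> N\<^sup>2" "L \<le> N" "k * n \<le> (k * n)\<^sup>2" "2 * p \<le> N" "0 < N"
proof -
  have p: "1 \<le> p" "1 \<le> L" using k by (auto simp: L)
  have pL: "L \<le> p * L" "p \<le> p * L" using mult_le_mono1[OF p(1), of L] mult_le_mono2[OF p(2), of p] by simp_all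
  then show "L \<le> N" "2 * p \<le> N" by (simp_all add: N mult.assoc)
  show "0 < N" using p by (simp add: N)
  then show "N \<le> N\<^sup>2" by (simp add: power2_eq_square)
  moreover have "L + p \<le> N" unfolding N mult.assoc using pL by linarith
  ultimately show "L + p < 2 ^ w" using word by linarith
  show "k * n \<le> (k * n)\<^sup>2" using n k by (simp add: power2_eq_square)
qed

lemma exec_init_prog:
  assumes "regs \<sigma> 0 = n"
  shows "exec w (init_prog k p) \<sigma> 26
    \<lparr>regs = (regs \<sigma>)(3 := n, 4 := L, 0 := N, 1 := (k * n)\<^sup>2, 2 := (k * n)\<^sup>2 + N\<^sup>2), mem = mem \<sigma>\<rparr>"
proof -
  note b = size_bounds word
  have np: "n * p < 2 ^ w" "n * p + 1 < 2 ^ w" "2 * p < 2 ^ w" "1 < (2 :: nat) ^ w" "k < 2 ^ w"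
    using b k word_gt[OF w] by (auto simp: L)
  have NN: "2 * p * L < 2 ^ w" "k * n < 2 ^ w" "k * n * (k * n) < 2 ^ w"
    "(k * n)\<^sup>2 + N * N < 2 ^ w" "N * N < 2 ^ w"
    using b by (auto simp: N[symmetric] power2_eq_square[symmetric])
  let ?r = "(regs \<sigma>)(3 := n)"
  let ?st = "\<lambda>r. \<lparr>regs = r, mem = mem \<sigma>\<rparr>"
  have 1: "exec w (SetReg 3 (Reg 0)) \<sigma> 2 (?st ?r)"
    using exec_SetReg_value[of w \<sigma> "Reg 0" n 2 3] assms by simp
  have 2: "exec w (SetReg 4 (Op Plus (Op Times (Reg 3) (Const p)) (Const 1))) (?st ?r) 6
      (?st (?r(4 := L)))"
    using exec_SetReg_value[of w "?st ?r" "Op Plus (Op Times (Reg 3) (Const p)) (Const 1)" L 6 4]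
      expr_val_Plus[OF expr_val_Times[OF _ expr_val_Const _, of w "?st ?r" "Reg 3" n p] expr_val_Const, of 1]
      np b k by (simp add: L)
  have 3: "exec w (SetReg 0 (Op Times (Const (2 * p)) (Reg 4))) (?st (?r(4 := L))) 4
      (?st (?r(4 := L, 0 := N)))"
    using exec_SetReg_value[of w "?st (?r(4 := L))" "Op Times (Const (2 * p)) (Reg 4)" N 4 0] np NN
    by (simp add: N)
  have 4: "exec w (SetReg 1 (Op Times (Op Times (Const k) (Reg 3)) (Op Times (Const k) (Reg 3))))
      (?st (?r(4 := L, 0 := N))) 8 (?st (?r(4 := L, 0 := N, 1 := (k * n)\<^sup>2)))"
    using exec_SetReg_value[of w "?st (?r(4 := L, 0 := N))"
        "Op Times (Op Times (Const k) (Reg 3)) (Op Times (Const k) (Reg 3))" "(k * n)\<^sup>2" 8 1] np NN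
    by (simp add: power2_eq_square)
  have 5: "exec w (SetReg 2 (Op Plus (Reg 1) (Op Times (Reg 0) (Reg 0))))
      (?st (?r(4 := L, 0 := N, 1 := (k * n)\<^sup>2))) 6
      (?st (?r(4 := L, 0 := N, 1 := (k * n)\<^sup>2, 2 := (k * n)\<^sup>2 + N\<^sup>2)))"
    using exec_SetReg_value[of w "?st (?r(4 := L, 0 := N, 1 := (k * n)\<^sup>2))"
        "Op Plus (Reg 1) (Op Times (Reg 0) (Reg 0))" "(k * n)\<^sup>2 + N\<^sup>2" 6 2] np NN
    by (simp add: power2_eq_square)
  from exec_Seq[OF 1 exec_Seq[OF 2 exec_Seq[OF 3 exec_Seq[OF 4 5]]]] show ?thesis
    unfolding init_prog_def by simp
qed

lemma exec_reduction_prog: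
  fixes G :: "nat pair_pre_digraph"
  assumes ts: "\<And>c r r'. (c, r, r') \<in> set ts \<longleftrightarrow> lk c r r'"
      "\<And>c r r'. lk c r r' \<Longrightarrow> 0 < c \<and> c \<le> p \<and> r \<le> p \<and> r' \<le> p"
  shows "\<exists>\<sigma>. exec w (reduction_prog k p ts) (clique_input k n G)
      (N\<^sup>2 * (expr_time (arc_expr k p ts) + 14) + 2 * p * 23 + 36) \<sigma> \<and>
    output_graph \<sigma> = gadget_graph k p n lk (\<lambda>i j. (i, j) \<in> parcs G) \<and>
    (\<forall>i<p. output_source \<sigma> i = node L i 0 0 \<and> output_target \<sigma> i = node L i 1 (n * p))"
proof -
  note b = size_bounds word
  let ?E = "\<lambda>i j. (i, j) \<in> parcs G"
  define \<sigma>0 where "\<sigma>0 = clique_input k n G"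
  define \<sigma>1 where "\<sigma>1 = \<lparr>regs = (regs \<sigma>0)(3 := n, 4 := L, 0 := N, 1 := (k * n)\<^sup>2,
     2 := (k * n)\<^sup>2 + N\<^sup>2), mem = mem \<sigma>0\<rparr>"
  define g where "g = (\<lambda>a. of_bool (gadget_arc k p n lk ?E (a div N) (a mod N)) :: nat)"
  define \<sigma>2 where "\<sigma>2 = filled 5 ((k * n)\<^sup>2) g \<sigma>1 (N\<^sup>2)"
  \<comment> \<open>Entry \<open>2 * i\<close> is the first vertex of the upper line of row
    \<open>i\<close>, entry \<open>2 * i + 1\<close> the last one of its lower line; the remainder
    switches the offset \<open>L - 1\<close> on.\<close>
  define h where "h = (\<lambda>x. x * L + x mod 2 * (L - 1))"
  define \<sigma>3 where "\<sigma>3 = filled 6 ((k * n)\<^sup>2 + N\<^sup>2) h \<sigma>2 (2 * p)"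
  \<comment> \<open>All writes go to addresses from \<open>(k * n)\<^sup>2\<close> on, so the input
    survives the loop that reads it.\<close>
  have E: "mem (filled 5 ((k * n)\<^sup>2) g \<sigma>1 m) (i * (k * n) + j) = of_bool (?E i j)"
    if "i < k * n" "j < k * n" for i j m
  proof -
    have "Suc i * (k * n) \<le> (k * n) * (k * n)" using that(1) by (intro mult_le_mono1) simp
    with that(2) have "i * (k * n) + j < (k * n)\<^sup>2" by (simp add: power2_eq_square)
    with that(2) n k(1) show ?thesis by (simp add: filled_def \<sigma>1_def \<sigma>0_def clique_input_def)
  qed
  have 1: "exec w (init_prog k p) \<sigma>0 26 \<sigma>1"
    unfolding \<sigma>1_def by (rule exec_init_prog) (simp add: \<sigma>0_def clique_input_def)
  have NN: "N * N = N\<^sup>2" by (simp add: power2_eq_square)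
  have "exec w (fill_loop 5 1 (Op Times (Reg 0) (Reg 0)) (arc_expr k p ts))
    (filled 5 ((k * n)\<^sup>2) g \<sigma>1 0)
    ((N\<^sup>2 - 0) * (expr_time (Op Times (Reg 0) (Reg 0)) + expr_time (arc_expr k p ts) + 11) +
       expr_time (Op Times (Reg 0) (Reg 0)) + 3) \<sigma>2"
    unfolding \<sigma>2_def
  proof (rule exec_fill_loop)
    fix j assume "j < N\<^sup>2"
    have "holds w (filled 5 ((k * n)\<^sup>2) g \<sigma>1 j) (arc_expr k p ts)
        (gadget_arc k p n lk ?E (j div N) (j mod N))"
      by (rule holds_arc_expr[OF w L[symmetric] n k])
         (use b \<open>j < N\<^sup>2\<close> ts E in \<open>auto simp: filled_def \<sigma>1_def\<close>)
    then show "expr_val w (filled 5 ((k * n)\<^sup>2) g \<sigma>1 j) (arc_expr k p ts) = g j"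
      by (simp add: holds_def g_def)
  qed (use b w in \<open>auto simp: filled_def \<sigma>1_def NN\<close>)
  then have 2: "exec w (fill_loop 5 1 (Op Times (Reg 0) (Reg 0)) (arc_expr k p ts)) \<sigma>1
    (N\<^sup>2 * (expr_time (arc_expr k p ts) + 14) + 6) \<sigma>2"
    by (subst (asm) filled_0) (simp_all add: \<sigma>1_def \<sigma>0_def clique_input_def add.commute)
  have counter: "regs \<sigma>2 6 = 0" by (simp add: \<sigma>2_def filled_def \<sigma>1_def \<sigma>0_def clique_input_def)
  let ?h = "Op Plus (Op Times (Reg 6) (Reg 4)) (Op Times (Op Rem (Reg 6) (Const 2)) (Op Minus (Reg 4) (Const 1)))"
  have "exec w (fill_loop 6 2 (Const (2 * p)) ?h)
    (filled 6 ((k * n)\<^sup>2 + N\<^sup>2) h \<sigma>2 0)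
    ((2 * p - 0) * (expr_time (Const (2 * p)) + expr_time ?h + 11) + expr_time (Const (2 * p)) + 3) \<sigma>3"
    unfolding \<sigma>3_def
  proof (rule exec_fill_loop)
    fix j assume j: "j < 2 * p"
    then have "Suc j * L \<le> N" unfolding N by (intro mult_le_mono1) simp
    then have 1: "j * L + L \<le> N" by simp
    have "j mod 2 * (L - 1) \<le> 1 * (L - 1)" by (intro mult_le_mono1) auto
    then have 2: "j mod 2 * (L - 1) \<le> L" by linarith
    have 3: "N < 2 ^ w" "j < 2 ^ w" using b j by linarith+
    have le: "j * L + j mod 2 * (L - 1) < 2 ^ w" "j mod 2 * (L - 1) < 2 ^ w"
      "j * L < 2 ^ w" "L - 1 < 2 ^ w" "j < 2 ^ w"
      using 1 2 3 by linarith+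
    show "expr_val w (filled 6 ((k * n)\<^sup>2 + N\<^sup>2) h \<sigma>2 j) ?h = h j"
      using le word_gt[OF w] w by (simp add: filled_def \<sigma>2_def \<sigma>1_def h_def)
  qed (use b w in \<open>auto simp: filled_def \<sigma>1_def \<sigma>2_def\<close>)
  then have 3: "exec w (fill_loop 6 2 (Const (2 * p)) ?h) \<sigma>2 (2 * p * 23 + 4) \<sigma>3"
    by (simp add: filled_0[OF counter] algebra_simps)
  have "exec w (reduction_prog k p ts) (clique_input k n G)
      (N\<^sup>2 * (expr_time (arc_expr k p ts) + 14) + 2 * p * 23 + 36) \<sigma>3"
    using exec_Seq[OF 1 exec_Seq[OF 2 3]] unfolding reduction_prog_def \<sigma>0_def
    by (simp add: algebra_simps)
  moreover have "output_graph \<sigma>3 = gadget_graph k p n lk ?E"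
  proof -
    have "mem \<sigma>3 ((k * n)\<^sup>2 + u * N + v) = of_bool (gadget_arc k p n lk ?E u v)" if "u < N" "v < N" for u v
    proof -
      have "Suc u * N \<le> N * N" using that(1) by (intro mult_le_mono1) simp
      with that(2) have "u * N + v < N\<^sup>2" by (simp add: power2_eq_square)
      with that(2) show ?thesis by (simp add: \<sigma>3_def \<sigma>2_def filled_def g_def)
    qed
    moreover have "regs \<sigma>3 0 = N" "regs \<sigma>3 1 = (k * n)\<^sup>2"
      by (simp_all add: \<sigma>3_def \<sigma>2_def \<sigma>1_def filled_def)
    ultimately show ?thesis
      unfolding output_graph_def gadget_graph_def Let_def L[symmetric] N[symmetric] by auto
  qed
  moreover have out: "mem \<sigma>3 (regs \<sigma>3 2 + x) = h x" if "x < 2 * p" for x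
    using that by (simp add: \<sigma>3_def \<sigma>2_def \<sigma>1_def filled_def)
  have "output_source \<sigma>3 i = node L i 0 0" if "i < p" for i
    using out[of "2 * i"] that by (simp add: output_source_def h_def node_def mult.commute)
  moreover have "output_target \<sigma>3 i = node L i 1 (n * p)" if "i < p" for i
  proof -
    have "(2 * i + 1) mod 2 = 1" by presburger
    with out[of "2 * i + 1"] that have "mem \<sigma>3 (regs \<sigma>3 2 + (2 * i + 1)) = (2 * i + 1) * L + (L - 1)"
      by (simp only: h_def)
    then show ?thesis by (simp add: output_target_def node_def L mult.commute)
  qed
  ultimately show ?thesis by blast
qed

end

section \<open>Covering all pairs by arithmetic progressions\<close>

text \<open>Passing from \<open>j\<close> to \<open>j + 2\<close> and shifting the index raises each
  of the \<open>j + 1\<close> summands by 1, and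
  \<open>(j + 2)\<^sup>2 = j\<^sup>2 + 4 * (j + 1)\<close>.\<close>

lemma sum_min_complement:
  fixes k :: nat
  shows "(\<Sum>d = 1..<k. min d (k - d)) = k\<^sup>2 div 4"
proof (induction k rule: nat_less_induct)
  case (1 k)
  consider "k = 0" | "k = 1" | j where "k = j + 2" by (metis One_nat_def add_2_eq_Suc' not0_implies_Suc)
  then show ?case
  proof cases
    case (3 j)
    have "(\<Sum>d = 1..<j + 2. min d (j + 2 - d)) = (\<Sum>d = 0..<j + 1. min (Suc d) (j + 1 - d))"
      using sum.shift_bounds_Suc_ivl[of "\<lambda>d. min d (j + 2 - d)" 0 "j + 1"] by simp
    also have "\<dots> = (\<Sum>d = 0..<j + 1. Suc (min d (j - d)))"
      by (intro sum.cong) auto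
    also have "\<dots> = j + 1 + (\<Sum>d = 0..<j + 1. min d (j - d))"
      by (simp only: sum_Suc) simp
    \<comment> \<open>The summands for \<open>d = 0\<close> and \<open>d = j\<close> vanish.\<close>
    also have "(\<Sum>d = 0..<j + 1. min d (j - d)) = (\<Sum>d = 1..<j. min d (j - d))"
      by (intro sum.mono_neutral_right) (auto simp: not_less_eq_eq)
    also have "\<dots> = j\<^sup>2 div 4" using 1 3 by simp
    also have "j + 1 + j\<^sup>2 div 4 = (j + 2)\<^sup>2 div 4"
    proof -
      have "(j + 2)\<^sup>2 = j\<^sup>2 + (j + 1) * 4" by (simp add: power2_eq_square algebra_simps)
      then show ?thesis by simp
    qed
    finally show ?thesis using 3 by simp
  qed simp_all
qed

text \<open>Members of one residue class modulo \<open>j - i\<close> differ by multiples of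
  \<open>j - i\<close>, so none fits strictly between \<open>i\<close> and \<open>j\<close>.\<close>

lemma residue_class_successive:
  assumes "i < j" "j < k"
  shows "successive {y. y < k \<and> y mod (j - i) = i mod (j - i)} i j"
proof -
  have "j mod (j - i) = i mod (j - i)"
    using assms mod_add_self1[of "j - i" i] by simp
  moreover have False if "i < y" "y < j" "y mod (j - i) = i mod (j - i)" for y
  proof -
    from that(3) have "(j - i) dvd (y - i)" using that(1) by (simp add: mod_eq_dvd_iff_nat)
    with that(1,2) assms show False by (auto dest: dvd_imp_le)
  qed
  ultimately show ?thesis using assms by (fastforce simp: successive_def)
qed

text \<open>
  The pairs \<open>i < j\<close> of difference \<open>d\<close> are the pairs of successive members of the residue classes
  modulo \<open>d\<close>; only \<open>min d (k - d)\<close> of these classes have at least two members, \<open>k\<^sup>2 div 4\<close> in total.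
\<close>

lemma ex_covering_row_sets:
  assumes "p = k + k\<^sup>2 div 4"
  shows "\<exists>Q :: nat \<Rightarrow> nat set. (\<forall>c. k \<le> c \<and> c < p \<longrightarrow> Q c \<noteq> {} \<and> Q c \<subseteq> {..<k}) \<and>
     (\<forall>i j. i < j \<and> j < k \<longrightarrow> (\<exists>c. k \<le> c \<and> c < p \<and> successive (Q c) i j))"
proof -
  define S where "S = (SIGMA d : {1..<k}. {..<min d (k - d)})"
  have "card S = k\<^sup>2 div 4" by (simp add: S_def card_SigmaI sum_min_complement[unfolded One_nat_def])
  moreover have "finite S" by (auto simp: S_def)
  ultimately obtain f where f: "bij_betw f {0..<k\<^sup>2 div 4} S"
    using ex_bij_betw_nat_finite[of S] by auto
  define Q where "Q = (\<lambda>c. {y. y < k \<and> y mod fst (f (c - k)) = snd (f (c - k))})"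
  have "Q c \<noteq> {} \<and> Q c \<subseteq> {..<k}" if "k \<le> c" "c < p" for c
  proof -
    have "f (c - k) \<in> S" using bij_betwE[OF f] that assms by simp
    \<comment> \<open>A remainder represents its own class, and it is a row since it is less than
      \<open>k - d\<close>.\<close>
    then have "snd (f (c - k)) \<in> Q c" by (auto simp: S_def Q_def)
    then show ?thesis by (auto simp: Q_def)
  qed
  moreover have "\<exists>c. k \<le> c \<and> c < p \<and> successive (Q c) i j" if ij: "i < j" "j < k" for i j
  proof -
    \<comment> \<open>From \<open>j < k\<close> follows \<open>i < k - (j - i)\<close>, which bounds
      the remainder of \<open>i\<close> too.\<close>
    have "(j - i, i mod (j - i)) \<in> S"
      using ij le_less_trans[OF mod_less_eq_dividend, of i "k - (j - i)" "j - i"] by (auto simp: S_def)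
    then have "(j - i, i mod (j - i)) \<in> f ` {0..<k\<^sup>2 div 4}"
      by (simp only: bij_betw_imp_surj_on[OF f])
    then obtain m where m: "m < k\<^sup>2 div 4" "f m = (j - i, i mod (j - i))" by force
    then have "successive (Q (k + m)) i j"
      using residue_class_successive[OF ij] by (simp add: Q_def)
    with m(1) assms show ?thesis by (intro exI[of _ "k + m"]) simp
  qed
  ultimately show ?thesis by (intro exI[of _ Q] conjI allI impI; simp)
qed

section \<open>Cliques as selections\<close>

text \<open>No arc joins vertices of one part, so a clique of \<open>k\<close> vertices meets each
  of the \<open>k\<close> parts exactly once; \<open>b i\<close> is the offset of its vertex within
  part \<open>i\<close>.\<close>

lemma has_clique_iff_selection:
  assumes G: "multipartite_graph k n G" and n: "0 < n"
  shows "has_clique k G \<longleftrightarrow>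
    (\<exists>b. (\<forall>i<k. b i < n) \<and> (\<forall>i j. i < j \<and> j < k \<longrightarrow> (i * n + b i, j * n + b j) \<in> parcs G))"
proof
  have part_iff: "u \<in> part n i \<longleftrightarrow> u div n = i" for u i
    using n by (auto simp: part_def div_nat_eqI mult.commute dividend_less_times_div
        intro: dividend_less_div_times[THEN order.strict_trans2])
  have verts: "u \<in> pverts G \<longleftrightarrow> u div n < k" for u
    using G by (auto simp: multipartite_graph_def part_iff)
  { assume "has_clique k G"
    then obtain S where S: "S \<subseteq> pverts G" "finite S" "card S = k"
      "\<And>u v. u \<in> S \<Longrightarrow> v \<in> S \<Longrightarrow> u \<noteq> v \<Longrightarrow> (u, v) \<in> parcs G"
      unfolding has_clique_def by blast
    have "inj_on (\<lambda>u. u div n) S"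
    proof (rule inj_onI, rule ccontr)
      fix u v assume uv: "u \<in> S" "v \<in> S" "u div n = v div n" "u \<noteq> v"
      then have "u div n < k" using S(1) verts by blast
      with uv G have "(u, v) \<notin> parcs G" by (simp add: multipartite_graph_def part_iff)
      with S(4) uv show False by blast
    qed
    then have "card ((\<lambda>u. u div n) ` S) = k" using S(3) by (simp add: card_image)
    moreover have "(\<lambda>u. u div n) ` S \<subseteq> {..<k}" using S(1) verts by auto
    ultimately have "(\<lambda>u. u div n) ` S = {..<k}" by (intro card_subset_eq) auto
    then have "\<forall>i<k. \<exists>u \<in> S. u div n = i" by (metis imageE lessThan_iff)
    then obtain f where f: "\<And>i. i < k \<Longrightarrow> f i \<in> S \<and> f i div n = i" by metis
    have fb: "i * n + f i mod n = f i" if "i < k" for i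
      using f[OF that] div_mult_mod_eq[of "f i" n] by simp
    show "\<exists>b. (\<forall>i<k. b i < n) \<and> (\<forall>i j. i < j \<and> j < k \<longrightarrow> (i * n + b i, j * n + b j) \<in> parcs G)"
    proof (intro exI[of _ "\<lambda>i. f i mod n"] conjI allI impI)
      fix i j assume ij: "i < j \<and> j < k"
      then have "f i \<noteq> f j" using f[of i] f[of j] by auto
      with ij S(4) f fb show "(i * n + f i mod n, j * n + f j mod n) \<in> parcs G" by simp
    qed (use n in simp) }
  assume "\<exists>b. (\<forall>i<k. b i < n) \<and> (\<forall>i j. i < j \<and> j < k \<longrightarrow> (i * n + b i, j * n + b j) \<in> parcs G)"
  then obtain b where b: "\<And>i. i < k \<Longrightarrow> b i < n"
    "\<And>i j. i < j \<Longrightarrow> j < k \<Longrightarrow> (i * n + b i, j * n + b j) \<in> parcs G" by blast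
  interpret pair_graph G using G by (simp add: multipartite_graph_def)
  let ?f = "\<lambda>i. i * n + b i"
  have div: "?f i div n = i" if "i < k" for i using b(1)[OF that] by simp
  have "inj_on ?f {..<k}" using div by (intro inj_on_inverseI[of _ "\<lambda>u. u div n"]) auto
  then have "card (?f ` {..<k}) = k" by (simp add: card_image)
  moreover have "?f ` {..<k} \<subseteq> pverts G" using div verts by auto
  moreover have "(?f i, ?f j) \<in> parcs G" if "i < k" "j < k" "?f i \<noteq> ?f j" for i j
  proof (cases i j rule: linorder_cases)
    case less
    with b(2) that show ?thesis by blast
  next
    case greater
    with b(2)[OF greater] that arcs_symmetric show ?thesis by blast
  qed (use that in simp)
  ultimately show "has_clique k G"
    unfolding has_clique_def by (intro exI[of _ "?f ` {..<k}"]) auto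
qed

text \<open>The program writes \<open>p\<close> terminal pairs only, so the output functions are
  known just below \<open>p\<close>.\<close>

lemma disjoint_paths_cong:
  assumes "\<And>i. i < p \<Longrightarrow> s i = s' i" "\<And>i. i < p \<Longrightarrow> t i = t' i"
  shows "disjoint_paths G p s t \<longleftrightarrow> disjoint_paths G p s' t'"
  using assms by (simp add: disjoint_paths_def internally_disjoint_def)

lemma disjoint_shortest_paths_cong:
  assumes "\<And>i. i < p \<Longrightarrow> s i = s' i" "\<And>i. i < p \<Longrightarrow> t i = t' i"
  shows "disjoint_shortest_paths G f p s t \<longleftrightarrow> disjoint_shortest_paths G f p s' t'"
  using assms by (simp add: disjoint_shortest_paths_def internally_disjoint_def)

section \<open>Resource bounds\<close>

lemma bigo_of_le_mult:
  fixes f g :: "nat \<Rightarrow> nat"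
  assumes "\<And>n. 1 \<le> n \<Longrightarrow> f n \<le> C * g n"
  shows "(\<lambda>n. real (f n)) \<in> O(\<lambda>n. real (g n))"
proof (rule bigoI)
  show "\<forall>\<^sub>F n in sequentially. norm (real (f n)) \<le> real C * norm (real (g n))"
    using eventually_ge_at_top[of 1]
    by eventually_elim (use assms in \<open>simp flip: of_nat_mult\<close>)
qed

text \<open>From \<open>n = 3\<close> on \<open>ln n\<close> is at least 1 and absorbs the additive
  constants.\<close>

lemma word_length_bigo:
  assumes "0 < k"
  shows "(\<lambda>n. real (A + 2 * ceillog2 n)) \<in> O(\<lambda>n. ln (real (k * n)))"
proof (rule bigoI)
  show "\<forall>\<^sub>F n in sequentially.
      norm (real (A + 2 * ceillog2 n)) \<le> (real A + 2 + 2 / ln 2) * norm (ln (real (k * n)))"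
    using eventually_ge_at_top[of 3]
  proof eventually_elim
    case (elim n)
    have "3 \<le> real n" using elim by simp
    with exp_le have "exp 1 \<le> real n" by linarith
    then have 1: "1 \<le> ln (real n)" using elim by (subst ln_ge_iff) auto
    have "n \<le> k * n" using assms by simp
    then have "real n \<le> real (k * n)" by (simp only: of_nat_le_iff)
    then have 2: "ln (real n) \<le> ln (real (k * n))" using elim assms by (subst ln_le_cancel_iff) auto
    have "real (ceillog2 n) \<le> log 2 (real n) + 1"
      using ceillog2_less_log[of n] elim by simp
    then have "real (A + 2 * ceillog2 n) \<le> real A + 2 + 2 / ln 2 * ln (real n)"
      by (simp add: log_def)
    also have "\<dots> \<le> (real A + 2) * ln (real n) + 2 / ln 2 * ln (real n)"
      using mult_left_mono[OF 1, of "real A + 2"] by simp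
    also have "\<dots> = (real A + 2 + 2 / ln 2) * ln (real n)" by (simp add: algebra_simps)
    also have "\<dots> \<le> (real A + 2 + 2 / ln 2) * ln (real (k * n))"
      using 2 by (intro mult_left_mono) auto
    finally show ?case using 1 2 by simp
  qed
qed

text \<open>One program with one set of bounds serves both problems, since both are equivalent to
  the same selection.\<close>

lemma clique_reduction_exists:
  fixes k p :: nat
  assumes k: "3 \<le> k" and p: "p = k + k\<^sup>2 div 4"
  shows "\<exists>c W T S.
     clique_reduction k p (\<lambda>G' s t. disjoint_paths G' p s t) c W T S \<and>
     clique_reduction k p (\<lambda>G' s t. disjoint_shortest_paths G' unit_weight p s t) c W T S \<and>
     (\<lambda>n. real (W n)) \<in> O(\<lambda>n. ln (real (k * n))) \<and>
     (\<lambda>n. real (T n)) \<in> O(\<lambda>n. (real (k * n))\<^sup>2) \<and>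
     (\<lambda>n. real (S n)) \<in> O(\<lambda>n. real (k * n))"
proof -
  obtain Q :: "nat \<Rightarrow> nat set" where
    "\<forall>c. k \<le> c \<and> c < p \<longrightarrow> Q c \<noteq> {} \<and> Q c \<subseteq> {..<k}"
    "\<forall>i j. i < j \<and> j < k \<longrightarrow> (\<exists>c. k \<le> c \<and> c < p \<and> successive (Q c) i j)"
    using ex_covering_row_sets[OF p] by (elim exE conjE)
  then have Q: "\<And>c. k \<le> c \<Longrightarrow> c < p \<Longrightarrow> Q c \<noteq> {} \<and> Q c \<subseteq> {..<k}"
    "\<And>i j. i < j \<Longrightarrow> j < k \<Longrightarrow> \<exists>c. k \<le> c \<and> c < p \<and> successive (Q c) i j"
    by simp_all
  have "k - 2 \<le> k\<^sup>2 div 4"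
  proof -
    have "4 * (k - 2) \<le> k\<^sup>2"
    proof -
      \<comment> \<open>This square is the origin of \<open>2 * k \<le> p + 2\<close>; the integers
        avoid truncated subtraction.\<close>
      have "0 \<le> (int k - 2)\<^sup>2" by simp
      then have "4 * (int k - 1) \<le> (int k)\<^sup>2" by (simp add: power2_eq_square algebra_simps)
      then have "int (4 * (k - 2)) \<le> int (k\<^sup>2)" using k by (simp add: of_nat_diff)
      then show ?thesis by (simp only: of_nat_le_iff)
    qed
    then show ?thesis by linarith
  qed
  moreover have "k\<^sup>2 \<ge> 4"
    using power_mono[of 2 k 2] k by simp
  ultimately have kp: "k < p" "2 * k \<le> p + 2" using p k by linarith+
  have gadget: "gadget k p n Q" if "0 < n" for n
    using Q kp k that by unfold_locales auto
  let ?lk = "link k p Q"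
  have lk: "0 < c \<and> c \<le> p \<and> r \<le> p \<and> r' \<le> p" if "?lk c r r'" for c r r'
  proof -
    \<comment> \<open>\<open>link\<close> does not mention \<open>n\<close>, so the facts can be
      taken from the gadget with \<open>n = 1\<close>.\<close>
    interpret gadget k p 1 Q by (rule gadget) simp
    show ?thesis
      using that k kp Min_Max_Q_less[of c] successive_less[of c r r'] by (auto simp: link_def)
  qed
  have "{(c, r, r'). ?lk c r r'} \<subseteq> {..p} \<times> {..p} \<times> {..p}" using lk by auto
  then have "finite {(c, r, r'). ?lk c r r'}" by (rule finite_subset) simp
  then obtain ts where "set ts = {(c, r, r'). ?lk c r r'}" using finite_list by blast
  then have ts: "\<And>c r r'. (c, r, r') \<in> set ts \<longleftrightarrow> ?lk c r r'" by simp
  define N where "N = (\<lambda>n. 2 * p * (n * p + 1))"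
  \<comment> \<open>The memory needs at most \<open>A * n\<^sup>2\<close> words;
    \<open>A < 2 ^ A\<close> and \<open>n \<le> 2 ^ ceillog2 n\<close> turn this into the word
    length \<open>A + 2 * ceillog2 n\<close>.\<close>
  define A where "A = k\<^sup>2 + (2 * p * (p + 1))\<^sup>2 + 2 * p"
  define W where "W = (\<lambda>n. A + 2 * ceillog2 n)"
  define T where "T = (\<lambda>n. (N n)\<^sup>2 * (expr_time (arc_expr k p ts) + 14) + 2 * p * 23 + 36)"
  have N_le: "N n \<le> 2 * p * (p + 1) * n" if "1 \<le> n" for n
    using that by (simp add: N_def algebra_simps)
  have word: "(k * n)\<^sup>2 + (N n)\<^sup>2 + 2 * p < 2 ^ w" if "1 \<le> n" "W n \<le> w" for n w
  proof -
    have "(N n)\<^sup>2 \<le> (2 * p * (p + 1) * n)\<^sup>2" using N_le[OF that(1)] by (rule power_mono) simp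
    moreover have "2 * p \<le> 2 * p * n\<^sup>2" using that(1) by simp
    ultimately have "(k * n)\<^sup>2 + (N n)\<^sup>2 + 2 * p \<le> A * n\<^sup>2"
      unfolding A_def power_mult_distrib add_mult_distrib by linarith
    also have "\<dots> < 2 ^ A * n\<^sup>2" using that(1) by simp
    also have "\<dots> \<le> 2 ^ A * (2 ^ ceillog2 n)\<^sup>2"
      by (intro mult_left_mono power_mono le_two_power_ceillog2) auto
    also have "\<dots> = 2 ^ W n" by (simp add: W_def power_add power_mult[symmetric] mult.commute)
    also have "\<dots> \<le> 2 ^ w" using that(2) by simp
    finally show ?thesis .
  qed
  \<comment> \<open>Abstracting from the problem \<open>P\<close> allows one run of the program to
    be analysed for both.\<close>
  have reduction: "clique_reduction k p P (reduction_prog k p ts) W T N"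
    if P: "\<And>n E s t. 0 < n \<Longrightarrow> (\<And>i. i < p \<Longrightarrow> s i = node (n * p + 1) i 0 0 \<and> t i = node (n * p + 1) i 1 (n * p)) \<Longrightarrow>
      P (gadget_graph k p n ?lk E) s t \<longleftrightarrow>
        (\<exists>b. (\<forall>i<k. b i < n) \<and> (\<forall>i j. i < j \<and> j < k \<longrightarrow> E (i * n + b i) (j * n + b j)))" for P
    unfolding clique_reduction_def
  proof (intro allI impI)
    fix n w :: nat and G :: "nat pair_pre_digraph"
    assume n: "1 \<le> n" and G: "multipartite_graph k n G" and w: "W n \<le> w"
    let ?E = "\<lambda>i j. (i, j) \<in> parcs G"
    interpret gadget k p n Q ?E by (rule gadget) (use n in simp)
    have "2 \<le> w" using w kp k by (simp add: W_def A_def)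
    moreover have "N n = 2 * p * (n * p + 1)" by (simp add: N_def)
    moreover have "0 < n" "0 < k" "k \<le> p" using n k kp by auto
    ultimately obtain \<sigma> where \<sigma>:
      "exec w (reduction_prog k p ts) (clique_input k n G) (T n) \<sigma>" "output_graph \<sigma> = H"
      "\<And>i. i < p \<Longrightarrow> output_source \<sigma> i = node (n * p + 1) i 0 0 \<and>
          output_target \<sigma> i = node (n * p + 1) i 1 (n * p)"
      using exec_reduction_prog[OF refl _ _ _ _ _ word[OF n w] ts lk, of G]
      unfolding T_def by blast
    have "P (output_graph \<sigma>) (output_source \<sigma>) (output_target \<sigma>) \<longleftrightarrow> has_clique k G"
      unfolding \<sigma>(2) using P[of n "output_source \<sigma>" "output_target \<sigma>" ?E] \<sigma>(3) n
        has_clique_iff_selection[OF G] by simp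
    moreover have "output_source \<sigma> i \<in> pverts H \<and> output_target \<sigma> i \<in> pverts H" if "i < p" for i
      using \<sigma>(3)[OF that] node_less[OF that] by (simp add: verts_H L_def)
    moreover have "card (pverts H) \<le> N n" by (simp add: verts_H N_def L_def)
    ultimately show "\<exists>\<tau> \<sigma>. exec w (reduction_prog k p ts) (clique_input k n G) \<tau> \<sigma> \<and> \<tau> \<le> T n \<and>
          dag (output_graph \<sigma>) \<and> card (pverts (output_graph \<sigma>)) \<le> N n \<and>
          (\<forall>i<p. output_source \<sigma> i \<in> pverts (output_graph \<sigma>) \<and>
                 output_target \<sigma> i \<in> pverts (output_graph \<sigma>)) \<and>
          (has_clique k G \<longleftrightarrow> P (output_graph \<sigma>) (output_source \<sigma>) (output_target \<sigma>))"
      using \<sigma>(1,2) dag_H by (intro exI[of _ "T n"] exI[of _ \<sigma>]) simp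
  qed
  have dp: "disjoint_paths (with_proj (gadget_graph k p n ?lk E)) p s t \<longleftrightarrow>
        (\<exists>b. (\<forall>i<k. b i < n) \<and> (\<forall>i j. i < j \<and> j < k \<longrightarrow> E (i * n + b i) (j * n + b j)))"
    and dsp: "disjoint_shortest_paths (with_proj (gadget_graph k p n ?lk E)) unit_weight p s t \<longleftrightarrow>
        (\<exists>b. (\<forall>i<k. b i < n) \<and> (\<forall>i j. i < j \<and> j < k \<longrightarrow> E (i * n + b i) (j * n + b j)))"
    if "0 < n" "\<And>i. i < p \<Longrightarrow> s i = node (n * p + 1) i 0 0 \<and> t i = node (n * p + 1) i 1 (n * p)"
    for n E s t
  proof -
    interpret gadget k p n Q E using gadget[OF that(1)] .
    show "disjoint_paths (with_proj H) p s t \<longleftrightarrow>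
        (\<exists>b. (\<forall>i<k. b i < n) \<and> (\<forall>i j. i < j \<and> j < k \<longrightarrow> E (i * n + b i) (j * n + b j)))"
      unfolding disjoint_paths_iff_selection[symmetric]
      by (rule disjoint_paths_cong) (use that(2) in \<open>simp_all add: L_def\<close>)
    show "disjoint_shortest_paths (with_proj H) unit_weight p s t \<longleftrightarrow>
        (\<exists>b. (\<forall>i<k. b i < n) \<and> (\<forall>i j. i < j \<and> j < k \<longrightarrow> E (i * n + b i) (j * n + b j)))"
      unfolding disjoint_shortest_paths_iff_selection[symmetric]
      by (rule disjoint_shortest_paths_cong) (use that(2) in \<open>simp_all add: L_def\<close>)
  qed
  have "(\<lambda>n. real (N n)) \<in> O(\<lambda>n. real (k * n))"
  proof (rule bigo_of_le_mult)
    fix n :: nat assume "1 \<le> n"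
    moreover have "n \<le> k * n" using k by simp
    ultimately show "N n \<le> 2 * p * (p + 1) * (k * n)"
      using N_le[of n] mult_le_mono2[of n "k * n" "2 * p * (p + 1)"] by linarith
  qed
  moreover have "(\<lambda>n. real (T n)) \<in> O(\<lambda>n. (real (k * n))\<^sup>2)"
  proof -
    define B where "B = (2 * p * (p + 1))\<^sup>2 * (expr_time (arc_expr k p ts) + 14) + 2 * p * 23 + 36"
    have "T n \<le> B * (k * n)\<^sup>2" if n: "1 \<le> n" for n
    proof -
      have "(N n)\<^sup>2 \<le> (2 * p * (p + 1) * n)\<^sup>2" using N_le[OF n] by (rule power_mono) simp
      then have "(N n)\<^sup>2 * (expr_time (arc_expr k p ts) + 14) \<le>
          (2 * p * (p + 1))\<^sup>2 * n\<^sup>2 * (expr_time (arc_expr k p ts) + 14)"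
        unfolding power_mult_distrib[symmetric] by (rule mult_le_mono1)
      moreover have "(2 * p * 23 + 36) * 1 \<le> (2 * p * 23 + 36) * n\<^sup>2" using n by (intro mult_le_mono2) simp
      ultimately have "T n \<le> B * n\<^sup>2" by (simp add: T_def B_def algebra_simps)
      also have "\<dots> \<le> B * (k * n)\<^sup>2" using k by (intro mult_le_mono2 power_mono) auto
      finally show ?thesis .
    qed
    from bigo_of_le_mult[where g = "\<lambda>n. (k * n)\<^sup>2", OF this] show ?thesis by simp
  qed
  moreover have "(\<lambda>n. real (W n)) \<in> O(\<lambda>n. ln (real (k * n)))"
    unfolding W_def using k by (intro word_length_bigo) simp
  ultimately show ?thesis
    using reduction[of "\<lambda>G' s t. disjoint_paths (with_proj G') p s t", OF dp]
      reduction[of "\<lambda>G' s t. disjoint_shortest_paths (with_proj G') unit_weight p s t", OF dsp]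
    by blast
qed

theorem theorem9:
  fixes k p :: nat
  assumes "k \<ge> 3" and "p = k + k\<^sup>2 div 4"
  shows "(\<exists>c W T S.
            clique_reduction k p (\<lambda>G' s t. disjoint_paths G' p s t) c W T S \<and>
            (\<lambda>n. real (W n)) \<in> O(\<lambda>n. ln (real (k * n))) \<and>
            (\<lambda>n. real (T n)) \<in> O(\<lambda>n. (real (k * n))\<^sup>2) \<and>
            (\<lambda>n. real (S n)) \<in> O(\<lambda>n. real (k * n))) \<and>
         (\<exists>c W T S.
            clique_reduction k p (\<lambda>G' s t. disjoint_shortest_paths G' unit_weight p s t) c W T S \<and>
            (\<lambda>n. real (W n)) \<in> O(\<lambda>n. ln (real (k * n))) \<and>
            (\<lambda>n. real (T n)) \<in> O(\<lambda>n. (real (k * n))\<^sup>2) \<and>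
            (\<lambda>n. real (S n)) \<in> O(\<lambda>n. real (k * n)))"
  using clique_reduction_exists[OF assms] by blast

end
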